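(* Let $f:\mathbb{R}^p\to\mathbb{R}$ be any convex function, let $f_n=n^{1/2}f$, and assume that $C$ is positive definite. Let $\hat\beta_n$ be the minimizer over $\beta\in\mathbb{R}^p$ of $\frac12\Vert y-X\beta\Vert_2^2+f_n(\beta)$ in the linear model described in the context. Then, as $n\to\infty$ with $p$ fixed, $\hat u_n:=\sqrt n(\hat\beta_n-\beta^0)$ converges in distribution to $$\hat u:=\operatorname{argmin}_{u\in\mathbb{R}^p}V(u),\qquad V(u)=\tfrac12u^TCu-u^TW+f'(\beta^0;u),$$ where $W\sim\mathcal N(0,\sigma^2C)$. More generally, the same conclusion (with the same limit $\hat u$) holds for any sequence of convex penalties of the form $f_n=n^{1/2}(f+\rho_n)$ such that $\rho_n(\beta)\to0$ for every $\beta\in\mathbb{R}^p$, and each $\rho_n$ is Lipschitz continuous with Lipschitz constant $c_n$, where $c_n\to0$ as $n\to\infty$.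
   Context: Linear model: $p$ is fixed and $\beta^0\in\mathbb{R}^p$ is a fixed vector. For each $n$, $y=X\beta^0+\varepsilon$ with $X=(X_1,\dots,X_n)^T\in\mathbb{R}^{n\times p}$ and $\varepsilon=(\varepsilon_1,\dots,\varepsilon_n)^T$, where $X_1,X_2,\dots$ are i.i.d. centered random vectors in $\mathbb{R}^p$ with covariance matrix $C$, $\varepsilon_1,\varepsilon_2,\dots$ are i.i.d. centered random variables with variance $\sigma^2$, and the sequences $(X_i)$ and $(\varepsilon_i)$ are independent. The directional derivative of a convex function $f$ at $x$ in direction $u$ is $f'(x;u)=\lim_{t\downarrow0}\frac{f(x+tu)-f(x)}{t}$. Convention: $\hat\beta_n$ is a random vector which is a minimizer of the stated objective whenever one exists. *)

theory Defs
  imports "HOL-Probability.Probability"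
begin

definition dir_deriv :: "('b::real_normed_vector \<Rightarrow> real) \<Rightarrow> 'b \<Rightarrow> 'b \<Rightarrow> real" where
  "dir_deriv f x u = Lim (at_right 0) (\<lambda>t. (f (x + t *\<^sub>R u) - f x) / t)"

definition pos_semidef :: "real^'p^'p \<Rightarrow> bool" where
  "pos_semidef A \<longleftrightarrow> transpose A = A \<and> (\<forall>u. 0 \<le> u \<bullet> (A *v u))"

definition pos_def :: "real^'p^'p \<Rightarrow> bool" where
  "pos_def A \<longleftrightarrow> transpose A = A \<and> (\<forall>u. u \<noteq> 0 \<longrightarrow> 0 < u \<bullet> (A *v u))"

text \<open>Meaningful for square-integrable \<open>Y\<close>: the Bochner integral of a non-integrable
  function is 0, so integrability has to be required separately.\<close>

definition covariance_matrix :: "'a measure \<Rightarrow> ('a \<Rightarrow> real^'p) \<Rightarrow> real^'p^'p" where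
  "covariance_matrix M Y =
     (\<chi> j k. \<integral>\<omega>. (Y \<omega> $ j - (\<integral>\<omega>'. Y \<omega>' $ j \<partial>M)) * (Y \<omega> $ k - (\<integral>\<omega>'. Y \<omega>' $ k \<partial>M)) \<partial>M)"

text \<open>The arguments are mean and variance (whereas \<^const>\<open>normal_density\<close> takes the standard
  deviation); variance 0 gives the point mass at the mean.\<close>

definition normal_law :: "real \<Rightarrow> real \<Rightarrow> real measure" where
  "normal_law m v =
     (if v = 0 then return borel m else density lborel (\<lambda>x. ennreal (normal_density m (sqrt v) x)))"

text \<open>A random vector is multivariate normal if all its linear combinations are (possibly
  degenerate) univariate normal; \<open>S\<close> may be singular.\<close>

definition mv_normal :: "'a measure \<Rightarrow> ('a \<Rightarrow> real^'p) \<Rightarrow> real^'p \<Rightarrow> real^'p^'p \<Rightarrow> bool" where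
  "mv_normal M Y m S \<longleftrightarrow> prob_space M \<and> Y \<in> borel_measurable M \<and> pos_semidef S \<and>
     (\<forall>t. distr M borel (\<lambda>\<omega>. t \<bullet> Y \<omega>) = normal_law (t \<bullet> m) (t \<bullet> (S *v t)))"

text \<open>The limit may live on another probability space. Measurability of the limit is part of the
  notion, since \<open>Z\<close> will be given as a pointwise argmin.\<close>

definition conv_in_distribution ::
  "'a measure \<Rightarrow> (nat \<Rightarrow> 'a \<Rightarrow> 'b::real_normed_vector) \<Rightarrow> 'c measure \<Rightarrow> ('c \<Rightarrow> 'b) \<Rightarrow> bool" where
  "conv_in_distribution M Zs N Z \<longleftrightarrow>
     (\<forall>n. Zs n \<in> borel_measurable M) \<and> Z \<in> borel_measurable N \<and>
     (\<forall>h::'b \<Rightarrow> real. continuous_on UNIV h \<and> bounded (range h) \<longrightarrow>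
        (\<lambda>n. \<integral>\<omega>. h (Zs n \<omega>) \<partial>M) \<longlonglongrightarrow> (\<integral>\<omega>. h (Z \<omega>) \<partial>N))"

text \<open>\<open>\<parallel>y - X b\<parallel>\<^sup>2 / 2 + pen b\<close> for the design with rows \<open>x 0, \<dots>, x (n - 1)\<close>.\<close>

definition penalized_ls ::
  "nat \<Rightarrow> (nat \<Rightarrow> real^'p) \<Rightarrow> (nat \<Rightarrow> real) \<Rightarrow> (real^'p \<Rightarrow> real) \<Rightarrow> real^'p \<Rightarrow> real" where
  "penalized_ls n x y pen b = 1/2 * (\<Sum>i<n. (y i - x i \<bullet> b)\<^sup>2) + pen b"

text \<open>The estimator is a random vector on the whole space, unconstrained at those outcomes where
  the objective has no minimizer.\<close>

definition penalized_ls_estimator ::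
  "'a measure \<Rightarrow> (nat \<Rightarrow> 'a \<Rightarrow> real^'p) \<Rightarrow> (nat \<Rightarrow> 'a \<Rightarrow> real) \<Rightarrow> (nat \<Rightarrow> real^'p \<Rightarrow> real)
     \<Rightarrow> (nat \<Rightarrow> 'a \<Rightarrow> real^'p) \<Rightarrow> bool" where
  "penalized_ls_estimator M X y pen bh \<longleftrightarrow>
     (\<forall>n. bh n \<in> borel_measurable M \<and>
       (\<forall>\<omega>\<in>space M.
          (\<exists>b. is_arg_min (penalized_ls n (\<lambda>i. X i \<omega>) (\<lambda>i. y i \<omega>) (pen n)) (\<lambda>_. True) b) \<longrightarrow>
          is_arg_min (penalized_ls n (\<lambda>i. X i \<omega>) (\<lambda>i. y i \<omega>) (pen n)) (\<lambda>_. True) (bh n \<omega>)))"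

definition limit_objective ::
  "real^'p^'p \<Rightarrow> (real^'p \<Rightarrow> real) \<Rightarrow> real^'p \<Rightarrow> real^'p \<Rightarrow> real^'p \<Rightarrow> real" where
  "limit_objective C f \<beta>0 w u = 1/2 * (u \<bullet> (C *v u)) - u \<bullet> w + dir_deriv f \<beta>0 u"

end

theory Submission
  imports Defs
begin

text \<open>In the local parameter \<open>u = sqrt n (b - \<beta>)\<close> the objective is, up to a constant,
  \<open>u\<^sup>T C\<^sub>n u / 2 - u\<^sup>T S\<^sub>n + D\<^sub>n u\<close>, where \<open>C\<^sub>n\<close> is the empirical second moment matrix of the
  design, \<open>S\<^sub>n\<close> the normalized score, and \<open>D\<^sub>n\<close> tends to the directional derivative of \<open>f\<close>
  uniformly on compact sets (the Lipschitz perturbation contributes at most \<open>c\<^sub>n |u|\<close>).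
  The limit objective grows quadratically around its minimizer \<open>A w\<close>, which is a Lipschitz function
  of the linear term \<open>w\<close>. A convex function that is uniformly close to it on a ball around \<open>A w\<close>
  therefore has all its minimizers in that ball. This argument is deterministic: it shows that the
  rescaled estimator is close to \<open>A S\<^sub>n\<close> whenever \<open>C\<^sub>n\<close> is close to \<open>C\<close> and \<open>S\<^sub>n\<close> stays in a bounded
  set, so only the law of large numbers for \<open>C\<^sub>n\<close> and the central limit theorem for \<open>S\<^sub>n\<close> are needed.
  The multivariate limit is reduced to one dimension by approximating a bounded continuous function by
  trigonometric polynomials.\<close>

section \<open>Directional derivatives of convex functions\<close>

text \<open>\<open>x + s *\<^sub>R u\<close> is the convex combination of \<open>x\<close> and
  \<open>x + t *\<^sub>R u\<close> with weight \<open>s/t\<close> on the latter, so chord slopes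
  from \<open>x\<close> grow with the step.\<close>

lemma convex_on_quotient_mono:
  fixes f :: "'b::real_normed_vector \<Rightarrow> real"
  assumes f: "convex_on UNIV f" and "0 < s" "s \<le> t"
  shows "(f (x + s *\<^sub>R u) - f x) / s \<le> (f (x + t *\<^sub>R u) - f x) / t"
proof -
  have "(1 - s/t) *\<^sub>R x + (s/t) *\<^sub>R (x + t *\<^sub>R u) = x + s *\<^sub>R u"
    using assms by (simp add: algebra_simps)
  moreover have "f ((1 - s/t) *\<^sub>R x + (s/t) *\<^sub>R (x + t *\<^sub>R u)) \<le> (1 - s/t) * f x + (s/t) * f (x + t *\<^sub>R u)"
    using assms by (intro convex_onD[OF f]) auto
  ultimately have "f (x + s *\<^sub>R u) \<le> (1 - s/t) * f x + (s/t) * f (x + t *\<^sub>R u)"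
    by (simp only:)
  then have "f (x + s *\<^sub>R u) - f x \<le> s * ((f (x + t *\<^sub>R u) - f x) / t)"
    by (simp add: algebra_simps diff_divide_distrib)
  then show ?thesis using \<open>0 < s\<close> by (simp add: divide_le_eq mult.commute)
qed

text \<open>The point \<open>x\<close> lies between \<open>x - u\<close> and
  \<open>x + t *\<^sub>R u\<close>, with weight \<open>t / (1 + t)\<close> on \<open>x - u\<close>.
  The resulting lower bound on the quotient is free of \<open>t\<close>, which keeps the infimum
  over all steps finite.\<close>

lemma convex_on_quotient_bound:
  fixes f :: "'b::real_normed_vector \<Rightarrow> real"
  assumes f: "convex_on UNIV f" and "0 < t"
  shows "f x - f (x - u) \<le> (f (x + t *\<^sub>R u) - f x) / t"
proof -
  let ?a = "t / (1 + t)"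
  have a: "1 - ?a = 1 / (1 + t)" using assms by (simp add: field_simps)
  have "(1 - ?a) *\<^sub>R (x + t *\<^sub>R u) + ?a *\<^sub>R (x - u) = ((1 - ?a) + ?a) *\<^sub>R x + ((1 - ?a) * t - ?a) *\<^sub>R u"
    by (simp only: scaleR_add_left scaleR_diff_left scaleR_add_right scaleR_diff_right scaleR_scaleR) simp
  also have "\<dots> = x" unfolding a using assms by (simp flip: add_divide_distrib)
  finally have eq: "(1 - ?a) *\<^sub>R (x + t *\<^sub>R u) + ?a *\<^sub>R (x - u) = x" .
  have "f ((1 - ?a) *\<^sub>R (x + t *\<^sub>R u) + ?a *\<^sub>R (x - u)) \<le> (1 - ?a) * f (x + t *\<^sub>R u) + ?a * f (x - u)"
    using assms by (intro convex_onD[OF f]) auto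
  then have "f x \<le> (1 / (1 + t)) * f (x + t *\<^sub>R u) + (t / (1 + t)) * f (x - u)"
    by (simp only: eq) (simp only: a)
  then have "(1 + t) * f x \<le> (1 + t) * ((1 / (1 + t)) * f (x + t *\<^sub>R u) + (t / (1 + t)) * f (x - u))"
    using assms by (intro mult_left_mono) auto
  also have "\<dots> = f (x + t *\<^sub>R u) + t * f (x - u)"
    using assms by (simp add: distrib_left)
  finally show ?thesis using \<open>0 < t\<close> by (simp add: field_simps)
qed

text \<open>\<open>Lim\<close> carries information only once a limit is known to exist. The
  quotients decrease with the step and are bounded below, so they tend to their infimum, which also
  lies below each of them.\<close>

lemma dir_deriv_tendsto_and_le:
  fixes f :: "'b::real_normed_vector \<Rightarrow> real"
  assumes f: "convex_on UNIV f"
  shows dir_deriv_tendsto: "((\<lambda>t. (f (x + t *\<^sub>R u) - f x) / t) \<longlongrightarrow> dir_deriv f x u) (at_right 0)" (is ?A)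
    and dir_deriv_le: "0 < t \<Longrightarrow> dir_deriv f x u \<le> (f (x + t *\<^sub>R u) - f x) / t"
proof -
  define q where "q t = (f (x + t *\<^sub>R u) - f x) / t" for t :: real
  define L where "L = Inf (q ` {0<..})"
  have bdd: "bdd_below (q ` {0<..})"
    using convex_on_quotient_bound[OF f] by (auto simp: q_def intro!: bdd_belowI2)
  have le: "L \<le> q t" if "0 < t" for t
    unfolding L_def using that bdd by (intro cInf_lower) auto
  have lim: "(q \<longlongrightarrow> L) (at_right 0)"
  proof (rule order_tendstoI)
    fix a assume "a < L"
    then show "\<forall>\<^sub>F t in at_right 0. a < q t"
      using le unfolding eventually_at_right_field by (intro exI[of _ 1]) force
  next
    fix a assume "L < a"
    then obtain t where t: "0 < t" "q t < a"
      unfolding L_def using cInf_lessD[of "q ` {0<..}" a] by auto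
    have "q s < a" if "0 < s" "s < t" for s
      using convex_on_quotient_mono[OF f \<open>0 < s\<close>, of t x u] that t(2) by (simp add: q_def)
    with t(1) show "\<forall>\<^sub>F t in at_right 0. q t < a"
      unfolding eventually_at_right_field by blast
  qed
  have "dir_deriv f x u = L"
    unfolding dir_deriv_def q_def[symmetric] by (rule tendsto_Lim[OF _ lim]) simp
  then show ?A "0 < t \<Longrightarrow> dir_deriv f x u \<le> (f (x + t *\<^sub>R u) - f x) / t"
    using lim le by (simp_all add: q_def[abs_def])
qed

lemma dir_deriv_0 [simp]: "convex_on UNIV f \<Longrightarrow> dir_deriv f x 0 = 0"
  using tendsto_unique[OF _ dir_deriv_tendsto[of f x 0] , of 0] by simp

text \<open>Substitution of \<open>t * s\<close> for the step in the limit. Positive homogeneity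
  later reduces lower bounds on the directional derivative to the unit sphere.\<close>

lemma dir_deriv_scaleR:
  fixes f :: "'b::real_normed_vector \<Rightarrow> real"
  assumes f: "convex_on UNIV f" and "0 < s"
  shows "dir_deriv f x (s *\<^sub>R u) = s * dir_deriv f x u"
proof -
  have "filterlim (\<lambda>t. t * s) (at_right 0) (at_right 0)"
    using filterlim_times_pos[OF filterlim_ident \<open>0 < s\<close>, of "0::real" 0] by (simp add: mult.commute)
  from filterlim_compose[OF dir_deriv_tendsto[OF f] this]
  have "((\<lambda>t. s * ((f (x + (t * s) *\<^sub>R u) - f x) / (t * s))) \<longlongrightarrow> s * dir_deriv f x u) (at_right 0)"
    by (rule tendsto_mult_left)
  then have "((\<lambda>t. (f (x + t *\<^sub>R (s *\<^sub>R u)) - f x) / t) \<longlongrightarrow> s * dir_deriv f x u) (at_right 0)"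
    by (rule Lim_transform_eventually) (use \<open>0 < s\<close> in simp)
  then show ?thesis
    using tendsto_unique[OF _ dir_deriv_tendsto[OF f]] by force
qed

lemma convex_on_affine_comp:
  fixes f :: "'b::real_vector \<Rightarrow> real"
  assumes f: "convex_on UNIV f"
  shows "convex_on UNIV (\<lambda>u. f (x + t *\<^sub>R u))"
proof (rule convex_onI)
  fix s :: real and a b :: 'b assume s: "0 < s" "s < 1"
  have "x + t *\<^sub>R ((1 - s) *\<^sub>R a + s *\<^sub>R b) = (1 - s) *\<^sub>R (x + t *\<^sub>R a) + s *\<^sub>R (x + t *\<^sub>R b)"
    by (simp add: algebra_simps)
  then show "f (x + t *\<^sub>R ((1 - s) *\<^sub>R a + s *\<^sub>R b)) \<le> (1 - s) * f (x + t *\<^sub>R a) + s * f (x + t *\<^sub>R b)"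
    using convex_onD[OF f, of s "x + t *\<^sub>R a" "x + t *\<^sub>R b"] s by simp
qed simp

text \<open>For each fixed step the quotient is convex in the direction, and the inequality survives
  the limit.\<close>

lemma convex_on_dir_deriv:
  fixes f :: "'b::real_normed_vector \<Rightarrow> real"
  assumes f: "convex_on UNIV f"
  shows "convex_on UNIV (dir_deriv f x)"
proof (rule convex_onI)
  fix s :: real and a b :: 'b assume s: "0 < s" "s < 1"
  show "dir_deriv f x ((1 - s) *\<^sub>R a + s *\<^sub>R b) \<le> (1 - s) * dir_deriv f x a + s * dir_deriv f x b"
  proof (rule tendsto_le[OF _ _ dir_deriv_tendsto[OF f]])
    show "((\<lambda>t. (1 - s) * ((f (x + t *\<^sub>R a) - f x) / t) + s * ((f (x + t *\<^sub>R b) - f x) / t))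
        \<longlongrightarrow> (1 - s) * dir_deriv f x a + s * dir_deriv f x b) (at_right 0)"
      by (intro tendsto_intros dir_deriv_tendsto f)
    have "(f (x + t *\<^sub>R ((1 - s) *\<^sub>R a + s *\<^sub>R b)) - f x) / t
        \<le> (1 - s) * ((f (x + t *\<^sub>R a) - f x) / t) + s * ((f (x + t *\<^sub>R b) - f x) / t)" if "0 < t" for t
    proof -
      let ?l = "f (x + t *\<^sub>R ((1 - s) *\<^sub>R a + s *\<^sub>R b))"
      have "?l \<le> (1 - s) * f (x + t *\<^sub>R a) + s * f (x + t *\<^sub>R b)"
        using convex_onD[OF convex_on_affine_comp[OF f], of s a b x t] s by simp
      then have "(?l - f x) / t \<le> ((1 - s) * (f (x + t *\<^sub>R a) - f x) + s * (f (x + t *\<^sub>R b) - f x)) / t"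
        using that by (intro divide_right_mono) (auto simp: algebra_simps)
      then show ?thesis by (simp add: add_divide_distrib)
    qed
    then show "\<forall>\<^sub>F t in at_right 0. (f (x + t *\<^sub>R ((1 - s) *\<^sub>R a + s *\<^sub>R b)) - f x) / t
        \<le> (1 - s) * ((f (x + t *\<^sub>R a) - f x) / t) + s * ((f (x + t *\<^sub>R b) - f x) / t)"
      unfolding eventually_at_right_field by (intro exI[of _ 1]) auto
  qed simp
qed simp

lemma continuous_on_convex_UNIV:
  fixes f :: "'b::euclidean_space \<Rightarrow> real"
  shows "convex_on UNIV f \<Longrightarrow> continuous_on S f"
  by (rule continuous_on_subset[OF convex_on_continuous[OF open_UNIV]]) auto

text \<open>Dini's argument: the difference quotients decrease to their limit.\<close>

lemma dir_deriv_uniform_on_compact: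
  fixes f :: "'b::euclidean_space \<Rightarrow> real"
  assumes f: "convex_on UNIV f" and K: "compact K" and e: "0 < e"
  shows "\<exists>T>0. \<forall>t u. 0 < t \<longrightarrow> t \<le> T \<longrightarrow> u \<in> K \<longrightarrow> (f (x + t *\<^sub>R u) - f x) / t < dir_deriv f x u + e"
proof -
  define G where "G t = {u. (f (x + t *\<^sub>R u) - f x) / t - dir_deriv f x u < e}" for t :: real
  have mono: "G t \<subseteq> G s" if "0 < s" "s \<le> t" for s t
  proof
    fix u assume "u \<in> G t"
    then show "u \<in> G s"
      using convex_on_quotient_mono[OF f that, of x u] by (simp add: G_def)
  qed
  have "open (G t)" for t
    unfolding G_def divide_inverse
    by (intro open_Collect_less continuous_intros continuous_on_convex_UNIV
          convex_on_affine_comp convex_on_dir_deriv f)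
  moreover have "K \<subseteq> (\<Union>t\<in>{0<..}. G t)"
  proof
    fix u
    have "\<forall>\<^sub>F t in at_right 0. (f (x + t *\<^sub>R u) - f x) / t < dir_deriv f x u + e"
      using dir_deriv_tendsto[OF f] e by (intro order_tendstoD) auto
    then obtain b where "0 < b" and
      b: "\<And>t. 0 < t \<Longrightarrow> t < b \<Longrightarrow> (f (x + t *\<^sub>R u) - f x) / t - dir_deriv f x u < e"
      unfolding eventually_at_right_field diff_less_eq by (auto simp: add.commute)
    have "u \<in> G (b/2)"
      unfolding G_def by (rule CollectI, rule b) (use \<open>0 < b\<close> in auto)
    with \<open>0 < b\<close> show "u \<in> (\<Union>t\<in>{0<..}. G t)" by (intro UN_I[of "b/2"]) auto
  qed
  ultimately obtain D where D: "D \<subseteq> {0<..}" "finite D" "K \<subseteq> (\<Union>t\<in>D. G t)"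
    using compactE_image[OF K, of "{0<..}" G] by metis
  \<comment> \<open>A smaller step gives a larger set \<open>G\<close>, so the smallest step of the
    finite subcover serves all of \<open>K\<close>. Inserting 1 keeps the minimum meaningful when
    \<open>D\<close> is empty.\<close>
  define T where "T = Min (insert 1 D)"
  have T: "0 < T" "\<And>t. t \<in> D \<Longrightarrow> T \<le> t"
    using D by (auto simp: T_def)
  have "u \<in> G t" if t: "0 < t" "t \<le> T" "u \<in> K" for t u
  proof -
    obtain d where "d \<in> D" "u \<in> G d" using D(3) t(3) by blast
    moreover have "t \<le> d" using T(2)[OF \<open>d \<in> D\<close>] t(2) by simp
    ultimately show ?thesis using mono[OF \<open>0 < t\<close>] by blast
  qed
  then show ?thesis using T by (intro exI[of _ T]) (auto simp: G_def less_diff_eq diff_less_eq add.commute)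
qed

text \<open>The constant is the minimum of the form over the compact unit sphere; homogeneity of
  degree two carries the bound to all vectors.\<close>

lemma pos_def_coercive:
  fixes C :: "real^'p^'p"
  assumes "pos_def C"
  obtains l where "0 < l" "\<And>u. l * (norm u)\<^sup>2 \<le> u \<bullet> (C *v u)"
proof -
  have "continuous_on (sphere (0::real^'p) 1) (\<lambda>u. u \<bullet> (C *v u))"
    by (intro continuous_intros)
  from continuous_attains_inf[OF compact_sphere _ this] obtain v
    where v: "v \<in> sphere 0 1" "\<And>u. u \<in> sphere 0 1 \<Longrightarrow> v \<bullet> (C *v v) \<le> u \<bullet> (C *v u)"
    by auto
  show ?thesis
  proof
    have "v \<noteq> 0" using v by auto
    then show "0 < v \<bullet> (C *v v)" using assms by (auto simp: pos_def_def)
    fix u :: "real^'p"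
    show "v \<bullet> (C *v v) * (norm u)\<^sup>2 \<le> u \<bullet> (C *v u)"
    proof (cases "u = 0")
      case False
      define z where "z = (1 / norm u) *\<^sub>R u"
      have u: "u = norm u *\<^sub>R z" and "z \<in> sphere 0 1" using False by (auto simp: z_def)
      have "u \<bullet> (C *v u) = (norm u)\<^sup>2 * (z \<bullet> (C *v z))"
        by (subst (1 2) u) (simp add: matrix_vector_mult_scaleR power2_eq_square)
      then show ?thesis using v(2)[OF \<open>z \<in> _\<close>] by (simp add: mult.commute mult_right_mono)
    qed simp
  qed
qed

section \<open>Stability of the minimizer\<close>

text \<open>The parallelogram identity: the exact deficit at the midpoint is the source of strong
  convexity below.\<close>

lemma quadratic_form_midpoint:
  fixes C :: "real^'p^'p"
  shows "((1/2) *\<^sub>R (a + b)) \<bullet> (C *v ((1/2) *\<^sub>R (a + b)))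
    = 1/2 * (a \<bullet> (C *v a)) + 1/2 * (b \<bullet> (C *v b)) - 1/4 * ((b - a) \<bullet> (C *v (b - a)))"
  by (simp add: matrix_vector_mult_scaleR matrix_vector_right_distrib matrix_vector_mult_diff_distrib
        inner_add_left inner_add_right inner_diff_left inner_diff_right algebra_simps)

text \<open>The minimizer is compared with the midpoint \<open>?m\<close>: its value is at most that
  at \<open>?m\<close>, which by convexity lies below the average of the two end values by an eighth
  of the form at \<open>u - u0\<close>. Doubling yields the factor \<open>l/4\<close>.\<close>

lemma limit_objective_growth:
  fixes C :: "real^'p^'p"
  assumes f: "convex_on UNIV f"
    and l: "\<And>u. l * (norm u)\<^sup>2 \<le> u \<bullet> (C *v u)"
    and u0: "\<And>u. limit_objective C f \<beta> w u0 \<le> limit_objective C f \<beta> w u"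
  shows "limit_objective C f \<beta> w u0 + l/4 * (norm (u - u0))\<^sup>2 \<le> limit_objective C f \<beta> w u"
proof -
  let ?m = "(1/2) *\<^sub>R (u0 + u)"
  have "dir_deriv f \<beta> ?m \<le> 1/2 * dir_deriv f \<beta> u0 + 1/2 * dir_deriv f \<beta> u"
    using convex_onD[OF convex_on_dir_deriv[OF f], of "1/2" u0 u \<beta>] by (simp add: scaleR_add_right)
  then have "limit_objective C f \<beta> w ?m
      \<le> 1/2 * limit_objective C f \<beta> w u0 + 1/2 * limit_objective C f \<beta> w u - 1/8 * ((u - u0) \<bullet> (C *v (u - u0)))"
    unfolding limit_objective_def quadratic_form_midpoint
    by (simp add: inner_add_left algebra_simps)
  with u0[of ?m] l[of "u - u0"] show ?thesis by simp
qed

lemma continuous_on_limit_objective: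
  "convex_on UNIV f \<Longrightarrow> continuous_on S (limit_objective C f \<beta> w)"
  unfolding limit_objective_def
  by (intro continuous_intros continuous_on_convex_UNIV convex_on_dir_deriv)

text \<open>By homogeneity the directional derivative is at least \<open>- L * norm u\<close>, so
  the quadratic term wins far out: the objective is positive outside a ball and zero at the origin.
  A minimizer over the ball is then global.\<close>

lemma limit_objective_minimizer:
  fixes C :: "real^'p^'p"
  assumes f: "convex_on UNIV f" and "0 < l" and l: "\<And>u. l * (norm u)\<^sup>2 \<le> u \<bullet> (C *v u)"
  obtains u0 where "\<And>u. limit_objective C f \<beta> w u0 \<le> limit_objective C f \<beta> w u"
proof -
  let ?V = "limit_objective C f \<beta> w"
  have "continuous_on (sphere 0 1) (dir_deriv f \<beta>)"
    by (intro continuous_on_convex_UNIV convex_on_dir_deriv f)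
  then obtain v where v: "\<And>u. u \<in> sphere 0 1 \<Longrightarrow> dir_deriv f \<beta> v \<le> dir_deriv f \<beta> u"
    using continuous_attains_inf[of "sphere 0 1" "dir_deriv f \<beta>"] by fastforce
  define L where "L = \<bar>dir_deriv f \<beta> v\<bar>"
  have D: "- L * norm u \<le> dir_deriv f \<beta> u" for u
  proof (cases "u = 0")
    case False
    define z where "z = (1 / norm u) *\<^sub>R u"
    have "dir_deriv f \<beta> u = norm u * dir_deriv f \<beta> z"
      using dir_deriv_scaleR[OF f, of "norm u" \<beta> z] False by (simp add: z_def)
    moreover have "- L \<le> dir_deriv f \<beta> z"
      using v[of z] False by (simp add: z_def L_def)
    ultimately show ?thesis
      using mult_left_mono[of "- L" "dir_deriv f \<beta> z" "norm u"] by (simp add: mult.commute)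
  qed (simp add: f)
  \<comment> \<open>Beyond this radius \<open>l/2 * norm u\<close> exceeds
    \<open>norm w + L\<close>, the slope with which the linear and directional terms can pull the
    objective down.\<close>
  define r where "r = 2 * (norm w + L) / l"
  have r: "0 \<le> r" using \<open>0 < l\<close> by (simp add: r_def L_def)
  have far: "0 < ?V u" if "r < norm u" for u
  proof -
    have "0 < norm u" using that r by linarith
    moreover have "norm w + L < l/2 * norm u"
      using that \<open>0 < l\<close> by (simp add: r_def field_simps)
    ultimately have "0 < (l/2 * norm u - (norm w + L)) * norm u" by simp
    moreover have "u \<bullet> w \<le> norm u * norm w" by (rule norm_cauchy_schwarz)
    ultimately show ?thesis
      using D[of u] l[of u] unfolding limit_objective_def
      by (simp add: algebra_simps power2_eq_square)
  qed
  have V0: "?V 0 = 0" by (simp add: limit_objective_def f)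
  obtain u0 where u0: "u0 \<in> cball 0 r" "\<And>u. u \<in> cball 0 r \<Longrightarrow> ?V u0 \<le> ?V u"
    using continuous_attains_inf[of "cball 0 r" ?V] continuous_on_limit_objective[OF f] r
    by (metis cball_eq_empty compact_cball not_less)
  have "?V u0 \<le> ?V u" for u
    using u0(2)[of u] u0(2)[of 0] far[of u] r V0 by (cases "norm u \<le> r") auto
  then show ?thesis by (rule that)
qed

section \<open>The minimizer of the limit objective as a function of the linear term\<close>

definition limit_argmin :: "real^'p^'p \<Rightarrow> (real^'p \<Rightarrow> real) \<Rightarrow> real^'p \<Rightarrow> real^'p \<Rightarrow> real^'p" where
  "limit_argmin C f \<beta> w = arg_min (limit_objective C f \<beta> w) (\<lambda>_. True)"

lemma is_arg_min_unconstrained: "is_arg_min g (\<lambda>_. True) a \<longleftrightarrow> (\<forall>x. g a \<le> (g x :: real))"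
  by (auto simp: is_arg_min_def not_less)

context
  fixes C :: "real^'p^'p" and f :: "real^'p \<Rightarrow> real" and \<beta> :: "real^'p" and l :: real
  assumes f: "convex_on UNIV f" and l_pos: "0 < l" and l: "\<And>u. l * (norm u)\<^sup>2 \<le> u \<bullet> (C *v u)"
begin

lemma limit_argmin_le: "limit_objective C f \<beta> w (limit_argmin C f \<beta> w) \<le> limit_objective C f \<beta> w u"
proof -
  obtain u0 where "is_arg_min (limit_objective C f \<beta> w) (\<lambda>_. True) u0"
    unfolding is_arg_min_unconstrained using limit_objective_minimizer[OF f l_pos l] by blast
  then have "is_arg_min (limit_objective C f \<beta> w) (\<lambda>_. True) (limit_argmin C f \<beta> w)"
    unfolding limit_argmin_def arg_min_def by (rule someI)
  then show ?thesis unfolding is_arg_min_unconstrained by blast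
qed

lemma limit_argmin_growth:
  "limit_objective C f \<beta> w (limit_argmin C f \<beta> w) + l/4 * (norm (u - limit_argmin C f \<beta> w))\<^sup>2
    \<le> limit_objective C f \<beta> w u"
  by (rule limit_objective_growth[OF f l limit_argmin_le])

lemma ex1_limit_argmin: "\<exists>!u. is_arg_min (limit_objective C f \<beta> w) (\<lambda>_. True) u"
proof (rule ex1I[of _ "limit_argmin C f \<beta> w"])
  fix u assume "is_arg_min (limit_objective C f \<beta> w) (\<lambda>_. True) u"
  then have "l/4 * (norm (u - limit_argmin C f \<beta> w))\<^sup>2 \<le> 0"
    using limit_argmin_growth[of w u] unfolding is_arg_min_unconstrained by (smt (verit))
  then show "u = limit_argmin C f \<beta> w"
    using l_pos by (simp add: mult_le_0_iff)
qed (use limit_argmin_le in \<open>simp add: is_arg_min_unconstrained\<close>)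

text \<open>The growth inequality at each minimizer is tested at the other one. In the sum the
  quadratic and directional terms cancel, and only the inner product of the two differences remains.
  This yields both the continuity of the argmin map and a bound on the minimizer for bounded
  \<open>w\<close>.\<close>

lemma limit_argmin_lipschitz:
  "norm (limit_argmin C f \<beta> w - limit_argmin C f \<beta> w') \<le> 2 / l * norm (w - w')"
proof -
  let ?a = "limit_argmin C f \<beta> w" and ?a' = "limit_argmin C f \<beta> w'"
  have "l/2 * (norm (?a - ?a'))\<^sup>2 \<le> (?a - ?a') \<bullet> (w - w')"
    using limit_argmin_growth[of w ?a'] limit_argmin_growth[of w' ?a]
    by (simp add: limit_objective_def norm_minus_commute inner_diff_left inner_diff_right)
  also have "\<dots> \<le> norm (?a - ?a') * norm (w - w')" by (rule norm_cauchy_schwarz)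
  finally have "norm (?a - ?a') * (l/2 * norm (?a - ?a')) \<le> norm (?a - ?a') * norm (w - w')"
    by (simp add: power2_eq_square mult_ac)
  then have "l/2 * norm (?a - ?a') \<le> norm (w - w')"
    by (cases "norm (?a - ?a') = 0") (auto simp: mult_le_cancel_left)
  then show ?thesis using l_pos by (simp add: field_simps)
qed

end

text \<open>If a point outside the ball did not exceed \<open>G u0\<close>, convexity would give a
  point of the bounding sphere with value at most \<open>G u0\<close>. There \<open>V\<close>
  exceeds \<open>V u0\<close> by at least \<open>k * d\<^sup>2\<close>, more than two errors
  \<open>h\<close> can hide. Hence closeness of \<open>G\<close> and \<open>V\<close> is required on
  the ball only, and a minimizer over the ball is global.\<close>

lemma convex_argmin_perturbation:
  fixes G V :: "'b::euclidean_space \<Rightarrow> real"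
  assumes G: "convex_on UNIV G" and "0 < d" "2 * h < k * d\<^sup>2"
    and V: "\<And>u. V u0 + k * (norm (u - u0))\<^sup>2 \<le> V u"
    and GV: "\<And>u. u \<in> cball u0 d \<Longrightarrow> \<bar>G u - V u\<bar> \<le> h"
  shows "\<exists>u. is_arg_min G (\<lambda>_. True) u"
    and "is_arg_min G (\<lambda>_. True) u \<Longrightarrow> dist u u0 \<le> d"
proof -
  have far: "G u0 < G u" if "d < dist u u0" for u
  proof (rule ccontr)
    assume "\<not> G u0 < G u"
    \<comment> \<open>This weight puts \<open>v\<close> at distance exactly \<open>d\<close> from
      \<open>u0\<close>.\<close>
    let ?s = "d / dist u u0"
    define v where "v = (1 - ?s) *\<^sub>R u0 + ?s *\<^sub>R u"
    have "v - u0 = ?s *\<^sub>R (u - u0)" by (simp add: v_def algebra_simps)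
    then have v: "norm (v - u0) = d" using that \<open>0 < d\<close> by (auto simp: dist_norm)
    have "G v \<le> (1 - ?s) * G u0 + ?s * G u"
      unfolding v_def using that \<open>0 < d\<close> by (intro convex_onD[OF G]) (auto simp: divide_le_eq_1)
    also have "\<dots> \<le> (1 - ?s) * G u0 + ?s * G u0"
      using \<open>\<not> G u0 < G u\<close> \<open>0 < d\<close> by (intro add_left_mono mult_left_mono) auto
    also have "\<dots> = G u0" by (simp add: algebra_simps)
    finally have "G v \<le> G u0" .
    moreover have "\<bar>G v - V v\<bar> \<le> h" "\<bar>G u0 - V u0\<bar> \<le> h"
      using v \<open>0 < d\<close> by (auto intro!: GV simp: dist_norm norm_minus_commute)
    ultimately show False using V[of v] v assms(3) by simp
  qed
  obtain m where m: "m \<in> cball u0 d" "\<And>u. u \<in> cball u0 d \<Longrightarrow> G m \<le> G u"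
    using continuous_attains_inf[of "cball u0 d" G] continuous_on_convex_UNIV[OF G] \<open>0 < d\<close>
    by (metis cball_eq_empty compact_cball not_less order_less_imp_le)
  have "G m \<le> G u" for u
    using m(2)[of u] m(2)[of u0] far[of u] \<open>0 < d\<close> by (cases "dist u u0 \<le> d") (auto simp: dist_commute)
  then show "\<exists>u. is_arg_min G (\<lambda>_. True) u" by (auto simp: is_arg_min_unconstrained)
  show "is_arg_min G (\<lambda>_. True) u \<Longrightarrow> dist u u0 \<le> d"
    using far[of u] unfolding is_arg_min_unconstrained by (meson not_less)
qed

section \<open>The least squares objective in the local parameter\<close>

lemma abs_quadratic_form_le:
  fixes E :: "real^'p^'p"
  shows "\<bar>u \<bullet> (E *v u)\<bar> \<le> (norm u)\<^sup>2 * (\<Sum>j\<in>UNIV. \<Sum>k\<in>UNIV. \<bar>E $ j $ k\<bar>)"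
proof -
  have "u \<bullet> (E *v u) = (\<Sum>j\<in>UNIV. \<Sum>k\<in>UNIV. u $ j * (E $ j $ k * u $ k))"
    by (simp add: inner_vec_def matrix_vector_mult_def sum_distrib_left)
  also have "\<bar>\<dots>\<bar> \<le> (\<Sum>j\<in>UNIV. \<Sum>k\<in>UNIV. \<bar>u $ j * (E $ j $ k * u $ k)\<bar>)"
    by (intro order_trans[OF sum_abs] sum_mono) simp
  also have "\<dots> \<le> (\<Sum>j\<in>UNIV. \<Sum>k\<in>UNIV. (norm u)\<^sup>2 * \<bar>E $ j $ k\<bar>)"
  proof (intro sum_mono)
    fix j k
    have "\<bar>u $ j * (E $ j $ k * u $ k)\<bar> = (\<bar>u $ j\<bar> * \<bar>u $ k\<bar>) * \<bar>E $ j $ k\<bar>"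
      by (simp add: abs_mult mult_ac)
    also have "\<dots> \<le> (norm u * norm u) * \<bar>E $ j $ k\<bar>"
      by (intro mult_right_mono mult_mono component_le_norm_cart) auto
    finally show "\<bar>u $ j * (E $ j $ k * u $ k)\<bar> \<le> (norm u)\<^sup>2 * \<bar>E $ j $ k\<bar>"
      by (simp add: power2_eq_square)
  qed
  finally show ?thesis by (simp add: sum_distrib_left)
qed

text \<open>This is \<open>X\<^sup>T X / n\<close>, and \<open>score\<close> is
  \<open>X\<^sup>T e / sqrt n\<close>. Both take deterministic sequences, so that the comparison of
  minimizers can be applied outcome by outcome. The matrix is given entrywise because its
  convergence comes from a scalar law of large numbers for each entry.\<close>

definition gram :: "nat \<Rightarrow> (nat \<Rightarrow> real^'p) \<Rightarrow> real^'p^'p" where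
  "gram n x = (\<chi> j k. (\<Sum>i<n. x i $ j * x i $ k) / n)"

definition score :: "nat \<Rightarrow> (nat \<Rightarrow> real^'p) \<Rightarrow> (nat \<Rightarrow> real) \<Rightarrow> real^'p" where
  "score n x e = (1 / sqrt n) *\<^sub>R (\<Sum>i<n. e i *\<^sub>R x i)"

lemma quadratic_form_gram: "u \<bullet> (gram n x *v u) = (\<Sum>i<n. (x i \<bullet> u)\<^sup>2) / n"
proof -
  have "u \<bullet> (gram n x *v u) = (\<Sum>j\<in>UNIV. \<Sum>k\<in>UNIV. \<Sum>i<n. (x i $ j * u $ j) * (x i $ k * u $ k) / n)"
    by (simp add: inner_vec_def matrix_vector_mult_def gram_def sum_distrib_left sum_distrib_right
          sum_divide_distrib mult_ac)
  also have "\<dots> = (\<Sum>i<n. \<Sum>j\<in>UNIV. \<Sum>k\<in>UNIV. (x i $ j * u $ j) * (x i $ k * u $ k) / n)"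
    by (subst sum.swap[of _ "{..<n}"]) (intro sum.cong refl sum.swap)
  also have "\<dots> = (\<Sum>i<n. (x i \<bullet> u)\<^sup>2 / n)"
    by (simp add: inner_vec_def power2_eq_square sum_product sum_divide_distrib)
  finally show ?thesis by (simp add: sum_divide_distrib)
qed

text \<open>At the shifted parameter the residual is
  \<open>e i - (x i \<bullet> u) / sqrt n\<close>. Expanding its square separates a term constant in
  \<open>u\<close>, the form of the Gram matrix, and the pairing with the score.\<close>

lemma penalized_ls_local:
  assumes "0 < n" and y: "\<And>i. i < n \<Longrightarrow> y i = x i \<bullet> \<beta> + e i"
  shows "penalized_ls n x y pen (\<beta> + (1 / sqrt n) *\<^sub>R u)
    = 1/2 * (\<Sum>i<n. (e i)\<^sup>2) + 1/2 * (u \<bullet> (gram n x *v u)) - u \<bullet> score n x e + pen (\<beta> + (1 / sqrt n) *\<^sub>R u)"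
proof -
  have "(y i - x i \<bullet> (\<beta> + (1 / sqrt n) *\<^sub>R u))\<^sup>2
      = (e i)\<^sup>2 + (x i \<bullet> u)\<^sup>2 / n - 2 * (u \<bullet> ((1 / sqrt n) *\<^sub>R (e i *\<^sub>R x i)))" if "i < n" for i
  proof -
    have "y i - x i \<bullet> (\<beta> + (1 / sqrt n) *\<^sub>R u) = e i - (x i \<bullet> u) / sqrt n"
      using y[OF that] by (simp add: inner_add_right)
    then show ?thesis
      using \<open>0 < n\<close> by (simp add: power2_diff power_divide inner_commute mult_ac)
  qed
  then have "(\<Sum>i<n. (y i - x i \<bullet> (\<beta> + (1 / sqrt n) *\<^sub>R u))\<^sup>2)
      = (\<Sum>i<n. (e i)\<^sup>2) + (\<Sum>i<n. (x i \<bullet> u)\<^sup>2) / n - 2 * (u \<bullet> score n x e)"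
    by (simp add: sum.distrib sum_subtractf score_def sum_divide_distrib sum_distrib_left
          inner_sum_right scaleR_sum_right)
  then show ?thesis
    unfolding penalized_ls_def quadratic_form_gram by (simp add: field_simps)
qed

text \<open>Squares of affine functions are convex, with explicit deficit
  \<open>s * (1 - s) * (p - q)\<^sup>2\<close>. The perturbation argument needs convexity of the
  whole objective.\<close>

lemma convex_on_penalized_ls:
  assumes "convex_on UNIV pen"
  shows "convex_on UNIV (penalized_ls n x y pen)"
  unfolding penalized_ls_def
proof (intro convex_on_add assms convex_on_cmul)
  show "convex_on UNIV (\<lambda>b. \<Sum>i<n. (y i - x i \<bullet> b)\<^sup>2)"
  proof (rule convex_onI)
    fix s :: real and a b assume s: "0 < s" "s < 1"
    have "(y i - x i \<bullet> ((1 - s) *\<^sub>R a + s *\<^sub>R b))\<^sup>2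
        \<le> (1 - s) * (y i - x i \<bullet> a)\<^sup>2 + s * (y i - x i \<bullet> b)\<^sup>2" for i
    proof -
      define p q where "p = y i - x i \<bullet> a" and "q = y i - x i \<bullet> b"
      have "y i - x i \<bullet> ((1 - s) *\<^sub>R a + s *\<^sub>R b) = (1 - s) * p + s * q"
        by (simp add: p_def q_def inner_add_right algebra_simps)
      moreover have "(1 - s) * p\<^sup>2 + s * q\<^sup>2 - ((1 - s) * p + s * q)\<^sup>2 = s * (1 - s) * (p - q)\<^sup>2"
        by (simp add: power2_eq_square algebra_simps)
      moreover have "0 \<le> s * (1 - s) * (p - q)\<^sup>2" using s by simp
      ultimately show ?thesis by (simp add: p_def q_def)
    qed
    then show "(\<Sum>i<n. (y i - x i \<bullet> ((1 - s) *\<^sub>R a + s *\<^sub>R b))\<^sup>2)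
        \<le> (1 - s) * (\<Sum>i<n. (y i - x i \<bullet> a)\<^sup>2) + s * (\<Sum>i<n. (y i - x i \<bullet> b)\<^sup>2)"
      unfolding sum_distrib_left sum.distrib[symmetric] by (intro sum_mono)
  qed simp
qed simp


text \<open>The data \<open>x\<close>, \<open>y\<close>, \<open>e\<close> are quantified inside the
  eventuality: neither \<open>h\<close> nor the threshold in \<open>n\<close> depends on them, so
  one threshold serves all outcomes with a bounded score and a small Gram error.\<close>

lemma penalized_ls_argmin_near_limit_argmin:
  fixes C :: "real^'p^'p" and \<rho> :: "nat \<Rightarrow> real^'p \<Rightarrow> real"
  assumes f: "convex_on UNIV f" and C: "pos_def C" and "0 < d"
    and pen: "\<And>n. 1 \<le> n \<Longrightarrow> convex_on UNIV (\<lambda>b. sqrt n * (f b + \<rho> n b))"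
    and \<rho>: "\<And>n. 1 \<le> n \<Longrightarrow> (c n)-lipschitz_on UNIV (\<rho> n)" and c: "c \<longlonglongrightarrow> 0"
  shows "\<exists>h>0. \<forall>\<^sub>F n in sequentially. \<forall>x y e. (\<forall>i<n. y i = x i \<bullet> \<beta> + e i) \<longrightarrow>
      norm (score n x e) \<le> R \<longrightarrow> (\<Sum>j\<in>UNIV. \<Sum>k\<in>UNIV. \<bar>gram n x $ j $ k - C $ j $ k\<bar>) \<le> h \<longrightarrow>
      (let P = penalized_ls n x y (\<lambda>b. sqrt n * (f b + \<rho> n b)) in
        (\<exists>b. is_arg_min P (\<lambda>_. True) b) \<and>
        (\<forall>b. is_arg_min P (\<lambda>_. True) b \<longrightarrow>
          dist (sqrt n *\<^sub>R (b - \<beta>)) (limit_argmin C f \<beta> (score n x e)) \<le> d))"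
proof -
  obtain l where "0 < l" and l: "\<And>u. l * (norm u)\<^sup>2 \<le> u \<bullet> (C *v u)"
    using pos_def_coercive[OF C] by metis
  note growth = limit_argmin_growth[OF f \<open>0 < l\<close> l]
  \<comment> \<open>By the Lipschitz bound this dominates the norm of every point within
    \<open>d\<close> of the limit minimizer, whenever the score has norm at most \<open>R\<close>.
    The absolute value covers a negative \<open>R\<close>.\<close>
  define R2 where "R2 = norm (limit_argmin C f \<beta> 0) + 2 / l * \<bar>R\<bar> + d"
  have "0 < R2" using \<open>0 < d\<close> \<open>0 < l\<close> by (simp add: R2_def add_nonneg_pos)
  \<comment> \<open>Three errors of size \<open>k\<close> will add up to \<open>3 * k\<close>, and
    the perturbation lemma asks for \<open>2 * (3 * k) < l/4 * d\<^sup>2\<close>; the divisor 8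
    leaves room.\<close>
  define k where "k = l/4 * d\<^sup>2 / 8"
  have "0 < k" using \<open>0 < d\<close> \<open>0 < l\<close> by (simp add: k_def)
  \<comment> \<open>Chosen so that half of the quadratic error, at most
    \<open>R2\<^sup>2 * h / 2\<close>, equals \<open>k\<close>.\<close>
  define h where "h = 2 * k / R2\<^sup>2"
  have "0 < h" using \<open>0 < k\<close> \<open>0 < R2\<close> by (simp add: h_def)
  obtain T where "0 < T" and T: "\<And>t u. 0 < t \<Longrightarrow> t \<le> T \<Longrightarrow> u \<in> cball 0 R2 \<Longrightarrow>
      (f (\<beta> + t *\<^sub>R u) - f \<beta>) / t < dir_deriv f \<beta> u + k"
    using dir_deriv_uniform_on_compact[OF f compact_cball \<open>0 < k\<close>] by metis
  have "(\<lambda>n. 1 / sqrt (real n)) \<longlonglongrightarrow> 0"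
    using tendsto_real_sqrt[OF lim_1_over_n] by (simp add: real_sqrt_divide)
  then have ev1: "\<forall>\<^sub>F n in sequentially. 1 / sqrt (real n) < T"
    using \<open>0 < T\<close> by (rule order_tendstoD)
  have "(\<lambda>n. c n * R2) \<longlonglongrightarrow> 0 * R2" by (intro tendsto_intros c)
  then have ev2: "\<forall>\<^sub>F n in sequentially. c n * R2 < k"
    using \<open>0 < k\<close> by (intro order_tendstoD) auto
  have main: "(let P = penalized_ls n x y (\<lambda>b. sqrt n * (f b + \<rho> n b)) in
        (\<exists>b. is_arg_min P (\<lambda>_. True) b) \<and>
        (\<forall>b. is_arg_min P (\<lambda>_. True) b \<longrightarrow>
          dist (sqrt n *\<^sub>R (b - \<beta>)) (limit_argmin C f \<beta> (score n x e)) \<le> d))"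
    if n: "1 / sqrt (real n) < T" "c n * R2 < k" "1 \<le> n" and y: "\<And>i. i < n \<Longrightarrow> y i = x i \<bullet> \<beta> + e i"
      and w: "norm (score n x e) \<le> R"
      and gr: "(\<Sum>j\<in>UNIV. \<Sum>k\<in>UNIV. \<bar>gram n x $ j $ k - C $ j $ k\<bar>) \<le> h" for n x y e
  proof -
    define s where "s = sqrt (real n)"
    have s: "0 < s" using n by (simp add: s_def)
    define W where "W = score n x e"
    define u0 where "u0 = limit_argmin C f \<beta> W"
    define P where "P = penalized_ls n x y (\<lambda>b. sqrt n * (f b + \<rho> n b))"
    \<comment> \<open>The part of the local objective that does not depend on \<open>u\<close>;
      subtracting it makes \<open>G\<close> directly comparable with the limit objective.\<close>
    define const where "const = 1/2 * (\<Sum>i<n. (e i)\<^sup>2) + s * (f \<beta> + \<rho> n \<beta>)"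
    define G where "G u = P (\<beta> + (1/s) *\<^sub>R u) + - const" for u
    have G: "convex_on UNIV G"
    proof -
      have "convex_on UNIV P" unfolding P_def by (rule convex_on_penalized_ls[OF pen[OF n(3)]])
      from convex_on_affine_comp[OF this] show ?thesis
        unfolding G_def[abs_def] by (rule convex_on_add) (simp add: convex_on_const)
    qed
    have R2: "norm u \<le> R2" if "u \<in> cball u0 d" for u
    proof -
      have "norm u \<le> norm u0 + d"
        using that norm_triangle_ineq[of u0 "u - u0"] by (simp add: dist_norm norm_minus_commute)
      moreover have "norm u0 \<le> norm (limit_argmin C f \<beta> 0) + norm (u0 - limit_argmin C f \<beta> 0)"
        using norm_triangle_ineq[of "limit_argmin C f \<beta> 0" "u0 - limit_argmin C f \<beta> 0"] by simp
      moreover have "norm (u0 - limit_argmin C f \<beta> 0) \<le> 2 / l * norm W"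
        using limit_argmin_lipschitz[OF f \<open>0 < l\<close> l, of \<beta> W 0] by (simp add: u0_def)
      moreover have "2 / l * norm W \<le> 2 / l * \<bar>R\<bar>"
        using w \<open>0 < l\<close> by (intro mult_left_mono) (auto simp: W_def)
      ultimately show ?thesis by (simp add: R2_def)
    qed
    have close: "\<bar>G u - limit_objective C f \<beta> W u\<bar> \<le> 3 * k" if u: "u \<in> cball u0 d" for u
    proof -
      \<comment> \<open>The score terms cancel because the limit objective is taken at
        \<open>W\<close>. The three remaining errors come from the Gram matrix, the difference
        quotient with step \<open>1/s\<close>, and the Lipschitz perturbation.\<close>
      have eq: "G u - limit_objective C f \<beta> W u = 1/2 * (u \<bullet> ((gram n x - C) *v u))
          + ((f (\<beta> + (1/s) *\<^sub>R u) - f \<beta>) / (1/s) - dir_deriv f \<beta> u)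
          + s * (\<rho> n (\<beta> + (1/s) *\<^sub>R u) - \<rho> n \<beta>)"
        using penalized_ls_local[of n y x \<beta> e "\<lambda>b. sqrt n * (f b + \<rho> n b)" u] y n
        by (simp add: G_def P_def const_def limit_objective_def W_def s_def algebra_simps)
      have "\<bar>u \<bullet> ((gram n x - C) *v u)\<bar> \<le> R2\<^sup>2 * h"
        using gr R2[OF u]
        by (intro order_trans[OF abs_quadratic_form_le] mult_mono power_mono) (auto intro: sum_nonneg)
      also have "\<dots> = 2 * k" using \<open>0 < R2\<close> by (simp add: h_def)
      finally have 1: "\<bar>1/2 * (u \<bullet> ((gram n x - C) *v u))\<bar> \<le> k" by simp
      \<comment> \<open>The quotient never falls below the directional derivative; the bound from
        above is the uniform one.\<close>
      have 2: "\<bar>(f (\<beta> + (1/s) *\<^sub>R u) - f \<beta>) / (1/s) - dir_deriv f \<beta> u\<bar> \<le> k"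
        using T[of "1/s" u] dir_deriv_le[OF f, of "1/s" \<beta> u] R2[OF u] s n(1) by (simp add: s_def)
      have "\<bar>\<rho> n (\<beta> + (1/s) *\<^sub>R u) - \<rho> n \<beta>\<bar> \<le> c n * (norm u / s)"
        using lipschitz_onD[OF \<rho>[OF n(3)], of "\<beta> + (1/s) *\<^sub>R u" \<beta>] s by (simp add: dist_norm)
      then have "s * \<bar>\<rho> n (\<beta> + (1/s) *\<^sub>R u) - \<rho> n \<beta>\<bar> \<le> s * (c n * (norm u / s))"
        using s by (intro mult_left_mono) auto
      also have "\<dots> = c n * norm u" using s by simp
      also have "\<dots> \<le> c n * R2"
        using R2[OF u] lipschitz_on_nonneg[OF \<rho>[OF n(3)]] by (rule mult_left_mono)
      also have "\<dots> \<le> k" using n by simp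
      finally have 3: "\<bar>s * (\<rho> n (\<beta> + (1/s) *\<^sub>R u) - \<rho> n \<beta>)\<bar> \<le> k" using s by (simp add: abs_mult)
      show ?thesis using 1 2 3 unfolding eq by linarith
    qed
    have k6: "2 * (3 * k) < l/4 * d\<^sup>2" using \<open>0 < k\<close> by (simp add: k_def)
    \<comment> \<open>The rescaling is a bijection with inverse
      \<open>b \<mapsto> s *\<^sub>R (b - \<beta>)\<close>, and a constant shift preserves
      minimizers.\<close>
    have arg: "is_arg_min G (\<lambda>_. True) u \<longleftrightarrow> is_arg_min P (\<lambda>_. True) (\<beta> + (1/s) *\<^sub>R u)" for u
    proof -
      have "b = \<beta> + (1/s) *\<^sub>R (s *\<^sub>R (b - \<beta>))" for b using s by simp
      then show ?thesis unfolding is_arg_min_unconstrained G_def by (metis add_le_cancel_right)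
    qed
    have "\<exists>b. is_arg_min P (\<lambda>_. True) b"
      using convex_argmin_perturbation(1)[OF G \<open>0 < d\<close> k6 growth[of \<beta> W, folded u0_def] close] arg by blast
    moreover have "dist (s *\<^sub>R (b - \<beta>)) u0 \<le> d" if "is_arg_min P (\<lambda>_. True) b" for b
    proof -
      have "is_arg_min G (\<lambda>_. True) (s *\<^sub>R (b - \<beta>))" unfolding arg using s that by simp
      then show ?thesis
        by (rule convex_argmin_perturbation(2)[OF G \<open>0 < d\<close> k6 growth[of \<beta> W, folded u0_def] close, rotated])
    qed
    ultimately show ?thesis unfolding Let_def P_def s_def u0_def W_def by blast
  qed
  have "\<forall>\<^sub>F n in sequentially. 1 / sqrt (real n) < T \<and> c n * R2 < k \<and> 1 \<le> n"
    using ev1 ev2 eventually_ge_at_top[of "1::nat"] by eventually_elim simp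
  then show ?thesis
    using main \<open>0 < h\<close> by (intro exI[of _ h] conjI) (auto elim!: eventually_mono)
qed

section \<open>Weak convergence in Euclidean space\<close>

lemma (in prob_space) expectation_diff_le:
  fixes u v :: "'a \<Rightarrow> real"
  assumes [measurable]: "integrable M u" "integrable M v" "A \<in> events"
    and "\<And>\<omega>. \<omega> \<in> space M \<Longrightarrow> \<omega> \<notin> A \<Longrightarrow> \<bar>u \<omega> - v \<omega>\<bar> \<le> e"
    and "\<And>\<omega>. \<omega> \<in> space M \<Longrightarrow> \<bar>u \<omega> - v \<omega>\<bar> \<le> K" and "0 \<le> e" "0 \<le> K"
  shows "\<bar>expectation u - expectation v\<bar> \<le> e + K * prob A"
proof -
  have "\<bar>expectation u - expectation v\<bar> = \<bar>expectation (\<lambda>\<omega>. u \<omega> - v \<omega>)\<bar>"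
    using assms(1,2) by simp
  also have "\<dots> \<le> expectation (\<lambda>\<omega>. \<bar>u \<omega> - v \<omega>\<bar>)"
    by (rule integral_abs_bound)
  also have "\<dots> \<le> expectation (\<lambda>\<omega>. e + K * indicator A \<omega>)"
    using assms(1,2,4-7)
    by (intro integral_mono) (auto simp: emeasure_eq_measure split: split_indicator intro: add_increasing)
  also have "\<dots> = e + K * prob A"
    using assms by (simp add: emeasure_eq_measure prob_space)
  finally show ?thesis .
qed

lemma (in prob_space) integrable_bounded:
  fixes u :: "'a \<Rightarrow> real"
  assumes "u \<in> borel_measurable M" "\<And>\<omega>. \<bar>u \<omega>\<bar> \<le> K"
  shows "integrable M u"
  using assms by (intro integrable_const_bound[where B=K]) auto

text \<open>The tail events decrease to the empty set, so continuity from above applies.\<close>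

lemma (in prob_space) ex_norm_tail_less:
  fixes Z :: "'a \<Rightarrow> 'c::{second_countable_topology, real_normed_vector}"
  assumes [measurable]: "Z \<in> borel_measurable M" and "0 < e"
  shows "\<exists>R. prob {\<omega>\<in>space M. R < norm (Z \<omega>)} < e"
proof -
  have "(\<lambda>n. prob {\<omega>\<in>space M. real n < norm (Z \<omega>)}) \<longlonglongrightarrow> prob (\<Inter>n. {\<omega>\<in>space M. real n < norm (Z \<omega>)})"
    by (intro finite_Lim_measure_decseq) (auto simp: decseq_def)
  moreover have "(\<Inter>n. {\<omega>\<in>space M. real n < norm (Z \<omega>)}) = {}"
  proof -
    have "\<exists>n. \<not> real n < norm (Z \<omega>)" for \<omega>
      using real_arch_simple[of "norm (Z \<omega>)"] by (auto simp: not_less)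
    then show ?thesis by blast
  qed
  ultimately have "\<forall>\<^sub>F n in sequentially. prob {\<omega>\<in>space M. real n < norm (Z \<omega>)} < e"
    using \<open>0 < e\<close> by (intro order_tendstoD(2)) auto
  then show ?thesis unfolding eventually_sequentially by blast
qed

section \<open>Trigonometric polynomials and approximation by them\<close>

inductive trig_poly :: "('c::real_inner \<Rightarrow> real) \<Rightarrow> bool" where
  wave: "trig_poly (\<lambda>x. a * cos (t \<bullet> x) + b * sin (t \<bullet> x))"
| add: "trig_poly f \<Longrightarrow> trig_poly g \<Longrightarrow> trig_poly (\<lambda>x. f x + g x)"

text \<open>The product-to-sum formulas turn a product of waves at \<open>t\<close> and
  \<open>s\<close> into waves at \<open>t - s\<close> and \<open>t + s\<close>. Closure under
  products is what makes polynomials in sines available.\<close>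

lemma trig_poly_wave_mult:
  assumes "trig_poly g"
  shows "trig_poly (\<lambda>x. (a * cos (t \<bullet> x) + b * sin (t \<bullet> x)) * g x)"
  using assms
proof induction
  case (wave c s d)
  have "(a * cos (t \<bullet> x) + b * sin (t \<bullet> x)) * (c * cos (s \<bullet> x) + d * sin (s \<bullet> x))
    = ((a * c + b * d) / 2 * cos ((t - s) \<bullet> x) + (b * c - a * d) / 2 * sin ((t - s) \<bullet> x))
      + ((a * c - b * d) / 2 * cos ((t + s) \<bullet> x) + (a * d + b * c) / 2 * sin ((t + s) \<bullet> x))" for x
    by (simp add: inner_diff_left inner_add_left cos_add cos_diff sin_add sin_diff field_simps)
  then show ?case by (simp only:) (intro trig_poly.intros)
next
  case (add f g)
  show ?case unfolding distrib_left by (rule trig_poly.add[OF add.IH])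
qed

lemma trig_poly_mult: "trig_poly f \<Longrightarrow> trig_poly g \<Longrightarrow> trig_poly (\<lambda>x. f x * g x)"
proof (induction rule: trig_poly.induct)
  case (wave a t b)
  then show ?case by (rule trig_poly_wave_mult)
next
  case (add f f')
  then show ?case unfolding distrib_right by (intro trig_poly.add)
qed

lemma trig_poly_const: "trig_poly (\<lambda>x. c)"
  using trig_poly.wave[of c 0 0] by simp

lemma trig_poly_sum: "finite I \<Longrightarrow> (\<And>i. i \<in> I \<Longrightarrow> trig_poly (f i)) \<Longrightarrow> trig_poly (\<lambda>x. \<Sum>i\<in>I. f i x)"
  by (induction I rule: finite_induct) (auto intro: trig_poly_const trig_poly.add)

lemma trig_poly_bounded: "trig_poly g \<Longrightarrow> \<exists>K. \<forall>x. \<bar>g x\<bar> \<le> K"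
proof (induction rule: trig_poly.induct)
  case (wave a t b)
  have "\<bar>a * cos (t \<bullet> x) + b * sin (t \<bullet> x)\<bar> \<le> \<bar>a\<bar> + \<bar>b\<bar>" for x
    by (intro order_trans[OF abs_triangle_ineq] add_mono) (auto simp: abs_mult mult_left_le)
  then show ?case by blast
next
  case (add f g)
  then obtain K L where "\<And>x. \<bar>f x\<bar> \<le> K" "\<And>x. \<bar>g x\<bar> \<le> L" by blast
  then have "\<bar>f x + g x\<bar> \<le> K + L" for x by (meson abs_triangle_ineq add_mono order_trans)
  then show ?case by blast
qed

lemma trig_poly_continuous: "trig_poly g \<Longrightarrow> continuous_on UNIV g"
  by (induction rule: trig_poly.induct) (auto intro!: continuous_intros)

text \<open>A linear functional of the sine coordinates is a sum of sines with frequencies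
  \<open>(1 / L) *\<^sub>R b\<close>; constants, sums and products stay in the class.\<close>

lemma real_polynomial_function_sin_trig_poly:
  fixes P :: "'c::euclidean_space \<Rightarrow> real"
  assumes "real_polynomial_function P"
  shows "trig_poly (\<lambda>x. P (\<Sum>b\<in>Basis. sin (x \<bullet> b / L) *\<^sub>R b))"
  using assms
proof induction
  case (linear P)
  interpret bounded_linear P by fact
  have "trig_poly (\<lambda>x. sin (x \<bullet> b / L) * P b)" for b
    using trig_poly.wave[of 0 "(1 / L) *\<^sub>R b" "P b"] by (simp add: inner_commute mult.commute)
  then show ?case
    unfolding sum scaleR real_scaleR_def by (intro trig_poly_sum) auto
qed (auto intro: trig_poly_const trig_poly.add trig_poly_mult)

text \<open>On the cube of side \<open>2 L\<close>, \<open>h\<close> is a continuous function of the coordinates \<open>sin (x\<^sub>b / L)\<close>,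
  and this function extends to the whole unit cube. Approximating it there by a polynomial gives a
  trigonometric polynomial that is bounded everywhere in terms of \<open>h\<close>.\<close>

lemma trig_poly_approx:
  fixes h :: "'c::euclidean_space \<Rightarrow> real"
  assumes h: "continuous_on UNIV h" and B: "\<And>x. \<bar>h x\<bar> \<le> B" and "0 < L" "0 < e"
  obtains g where "trig_poly g" "\<And>x. norm x \<le> L \<Longrightarrow> \<bar>h x - g x\<bar> \<le> e" "\<And>x. \<bar>g x\<bar> \<le> B + e"
proof -
  define S where "S x = (\<Sum>b\<in>Basis. sin (x \<bullet> b / L) *\<^sub>R b)" for x :: 'c
  define H where "H z = h (\<Sum>b\<in>Basis. (L * arcsin (z \<bullet> b)) *\<^sub>R b)" for z :: 'c
  have comp: "S x \<bullet> b = sin (x \<bullet> b / L)" if "b \<in> Basis" for x b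
    using that by (simp add: S_def inner_sum_left inner_Basis if_distrib cong: if_cong)
  have S: "S x \<in> cbox (- One) One" for x
    by (simp add: mem_box comp)
  have "continuous_on (cbox (- One) One) H"
    unfolding H_def by (intro continuous_on_compose2[OF h] continuous_intros ballI) (auto simp: mem_box)
  then obtain P where P: "real_polynomial_function P"
    "\<And>z. z \<in> cbox (- One) One \<Longrightarrow> \<bar>H z - P z\<bar> < e"
    using Stone_Weierstrass_real_polynomial_function[OF compact_cbox _ \<open>0 < e\<close>] by metis
  show ?thesis
  proof
    show "trig_poly (\<lambda>x. P (S x))"
      unfolding S_def by (rule real_polynomial_function_sin_trig_poly[OF P(1)])
    \<comment> \<open>This holds without a restriction on \<open>x\<close>: \<open>S x\<close> never
      leaves the cube on which \<open>P\<close> is within \<open>e\<close> of \<open>H\<close>, and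
      \<open>H\<close> inherits the bound of \<open>h\<close>.\<close>
    show "\<bar>P (S x)\<bar> \<le> B + e" for x
      using P(2)[OF S, of x] B[of "\<Sum>b\<in>Basis. (L * arcsin (S x \<bullet> b)) *\<^sub>R b"] by (simp add: H_def)
    show "\<bar>h x - P (S x)\<bar> \<le> e" if "norm x \<le> L" for x
    proof -
      have "L * arcsin (S x \<bullet> b) = x \<bullet> b" if "b \<in> Basis" for b
      proof -
        have "\<bar>x \<bullet> b\<bar> \<le> L"
          using Basis_le_norm[OF that, of x] \<open>norm x \<le> L\<close> by linarith
        then have "\<bar>x \<bullet> b / L\<bar> \<le> 1"
          using \<open>0 < L\<close> by (simp add: abs_divide)
        \<comment> \<open>The scale \<open>L\<close> keeps the argument in \<open>[-1, 1]\<close>,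
          inside the interval from \<open>-pi/2\<close> to \<open>pi/2\<close> on which
          \<open>arcsin\<close> inverts \<open>sin\<close>.\<close>
        then have "arcsin (sin (x \<bullet> b / L)) = x \<bullet> b / L"
          using pi_gt3 by (intro arcsin_sin; linarith)
        then show ?thesis using that \<open>0 < L\<close> by (simp add: comp)
      qed
      then have "H (S x) = h (\<Sum>b\<in>Basis. (x \<bullet> b) *\<^sub>R b)"
        unfolding H_def by (intro arg_cong[of _ _ h] sum.cong) auto
      then show ?thesis using P(2)[OF S, of x] by (simp add: euclidean_representation)
    qed
  qed
qed

text \<open>Inside the ball the functions differ by at most \<open>e\<close>; outside they differ by
  at most \<open>K\<close>, on an event of probability below \<open>e\<close>.\<close>

lemma (in prob_space) expectation_diff_le_of_ball:
  fixes Y :: "'a \<Rightarrow> 'c::{second_countable_topology, real_normed_vector}"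
  assumes [measurable]: "Y \<in> borel_measurable M"
    and "integrable M (\<lambda>\<omega>. h (Y \<omega>))" "integrable M (\<lambda>\<omega>. g (Y \<omega>))"
    and "\<And>x. norm x \<le> L \<Longrightarrow> \<bar>h x - g x\<bar> \<le> e" "\<And>x. \<bar>h x - g x\<bar> \<le> K" "0 \<le> K"
    and "prob {\<omega>\<in>space M. R < norm (Y \<omega>)} < e" "R \<le> L"
  shows "\<bar>expectation (\<lambda>\<omega>. h (Y \<omega>)) - expectation (\<lambda>\<omega>. g (Y \<omega>))\<bar> \<le> (K + 1) * (e::real)"
proof -
  have "0 < e" using assms(7) measure_nonneg le_less_trans by blast
  have "prob {\<omega>\<in>space M. L < norm (Y \<omega>)} \<le> prob {\<omega>\<in>space M. R < norm (Y \<omega>)}"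
    using \<open>R \<le> L\<close> by (intro finite_measure_mono) auto
  then have "K * prob {\<omega>\<in>space M. L < norm (Y \<omega>)} \<le> K * e"
    using assms by (intro mult_left_mono) auto
  moreover have "\<bar>expectation (\<lambda>\<omega>. h (Y \<omega>)) - expectation (\<lambda>\<omega>. g (Y \<omega>))\<bar>
      \<le> e + K * prob {\<omega>\<in>space M. L < norm (Y \<omega>)}"
    using \<open>0 < e\<close> assms by (intro expectation_diff_le) auto
  ultimately show ?thesis by (simp add: algebra_simps)
qed

text \<open>A form of Levy's continuity theorem with tightness assumed and the limit given.
  Tightness confines all but little mass to a ball; there \<open>h\<close> is replaced by a
  trigonometric polynomial, whose expectations converge by hypothesis.\<close>

lemma weak_convergence_of_trig:
  fixes Z :: "nat \<Rightarrow> 'a \<Rightarrow> 'c::euclidean_space" and Z0 :: "'b \<Rightarrow> 'c"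
  assumes "prob_space M" "prob_space N"
    and Z [measurable]: "\<And>n. Z n \<in> borel_measurable M" and Z0 [measurable]: "Z0 \<in> borel_measurable N"
    and cos: "\<And>t. (\<lambda>n. \<integral>\<omega>. cos (t \<bullet> Z n \<omega>) \<partial>M) \<longlonglongrightarrow> (\<integral>\<omega>. cos (t \<bullet> Z0 \<omega>) \<partial>N)"
    and sin: "\<And>t. (\<lambda>n. \<integral>\<omega>. sin (t \<bullet> Z n \<omega>) \<partial>M) \<longlonglongrightarrow> (\<integral>\<omega>. sin (t \<bullet> Z0 \<omega>) \<partial>N)"
    and tight: "\<And>e. 0 < e \<Longrightarrow> \<exists>R. \<forall>\<^sub>F n in sequentially. measure M {\<omega>\<in>space M. R < norm (Z n \<omega>)} < e"
    and h: "continuous_on UNIV h" "bounded (range (h :: 'c \<Rightarrow> real))"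
  shows "(\<lambda>n. \<integral>\<omega>. h (Z n \<omega>) \<partial>M) \<longlonglongrightarrow> (\<integral>\<omega>. h (Z0 \<omega>) \<partial>N)"
proof -
  interpret M: prob_space M by fact
  interpret N: prob_space N by fact
  have int: "integrable M (\<lambda>\<omega>. g (Z n \<omega>))" "integrable N (\<lambda>\<omega>. g (Z0 \<omega>))"
    if g: "continuous_on UNIV g" and K: "\<And>x. \<bar>g x\<bar> \<le> K" for g :: "'c \<Rightarrow> real" and K n
  proof -
    have [measurable]: "g \<in> borel_measurable borel" using g by (rule borel_measurable_continuous_onI)
    show "integrable M (\<lambda>\<omega>. g (Z n \<omega>))" "integrable N (\<lambda>\<omega>. g (Z0 \<omega>))"
      using K by (auto intro!: M.integrable_bounded N.integrable_bounded)
  qed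
  have trig: "(\<lambda>n. \<integral>\<omega>. g (Z n \<omega>) \<partial>M) \<longlonglongrightarrow> (\<integral>\<omega>. g (Z0 \<omega>) \<partial>N)" if "trig_poly g" for g
    using that
  proof induction
    case (wave a t b)
    have "integrable M (\<lambda>\<omega>. cos (t \<bullet> Z n \<omega>))" "integrable M (\<lambda>\<omega>. sin (t \<bullet> Z n \<omega>))"
      "integrable N (\<lambda>\<omega>. cos (t \<bullet> Z0 \<omega>))" "integrable N (\<lambda>\<omega>. sin (t \<bullet> Z0 \<omega>))" for n
      by (auto intro!: M.integrable_bounded[where K=1] N.integrable_bounded[where K=1])
    then show ?case by (simp) (intro tendsto_intros cos sin)
  next
    case (add f g)
    obtain K L where KL: "\<And>x. \<bar>f x\<bar> \<le> K" "\<And>x. \<bar>g x\<bar> \<le> L"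
      using trig_poly_bounded[OF add.hyps(1)] trig_poly_bounded[OF add.hyps(2)] by auto
    note c = trig_poly_continuous[OF add.hyps(1)] trig_poly_continuous[OF add.hyps(2)]
    show ?case
      using tendsto_add[OF add.IH] int[OF c(1) KL(1)] int[OF c(2) KL(2)] by simp
  qed
  obtain B where B: "\<And>x. \<bar>h x\<bar> \<le> B" using h(2) by (auto simp: bounded_iff)
  have "0 \<le> B" using B[of 0] by linarith
  show ?thesis
  proof (rule LIMSEQ_I)
    fix r :: real assume "0 < r"
    \<comment> \<open>Replacing \<open>h\<close> by \<open>g\<close> costs
      \<open>(2 * B + 2) * e\<close> for each of the two expectations, and the convergence for
      \<open>g\<close> costs one more \<open>e\<close>: in all \<open>(4 * B + 5) * e\<close>,
      within \<open>(4 * (B + 2)) * e\<close>. The cap 1 gives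
      \<open>\<bar>h x - g x\<bar> \<le> 2 * B + 1\<close>.\<close>
    define e where "e = min 1 (r / (4 * (B + 2)))"
    have e: "0 < e" "e \<le> 1" using \<open>0 < r\<close> \<open>0 \<le> B\<close> by (auto simp: e_def)
    have "e \<le> r / (4 * (B + 2))" by (simp add: e_def)
    then have "(4 * (B + 2)) * e \<le> r"
      using \<open>0 \<le> B\<close> pos_le_divide_eq[of "4 * (B + 2)" e r] by (simp add: mult.commute)
    obtain R1 where R1: "\<forall>\<^sub>F n in sequentially. measure M {\<omega>\<in>space M. R1 < norm (Z n \<omega>)} < e"
      using tight[OF e(1)] by blast
    obtain R2 where R2: "N.prob {\<omega>\<in>space N. R2 < norm (Z0 \<omega>)} < e"
      using N.ex_norm_tail_less[OF Z0 e(1)] by blast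
    define L where "L = max 1 (max R1 R2)"
    have "0 < L" by (simp add: L_def)
    obtain g where g: "trig_poly g" "\<And>x. norm x \<le> L \<Longrightarrow> \<bar>h x - g x\<bar> \<le> e" "\<And>x. \<bar>g x\<bar> \<le> B + e"
      by (rule trig_poly_approx[OF h(1) B \<open>0 < L\<close> e(1)]) (rule that)
    note gc = trig_poly_continuous[OF g(1)]
    have bound: "\<bar>h x - g x\<bar> \<le> 2 * B + 1" for x
      using B[of x] g(3)[of x] e by linarith
    have cN: "\<bar>(\<integral>\<omega>. h (Z0 \<omega>) \<partial>N) - (\<integral>\<omega>. g (Z0 \<omega>) \<partial>N)\<bar> \<le> (2 * B + 2) * e"
      using N.expectation_diff_le_of_ball[where L=L and K="2 * B + 1", OF Z0 int(2)[OF h(1) B] int(2)[OF gc g(3)] g(2) bound _ R2]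
        \<open>0 \<le> B\<close> by (simp add: L_def algebra_simps)
    have "\<forall>\<^sub>F n in sequentially. \<bar>(\<integral>\<omega>. g (Z n \<omega>) \<partial>M) - (\<integral>\<omega>. g (Z0 \<omega>) \<partial>N)\<bar> < e"
      using tendstoD[OF trig[OF g(1)] e(1)] by (simp add: dist_real_def)
    with R1 have "\<forall>\<^sub>F n in sequentially. norm ((\<integral>\<omega>. h (Z n \<omega>) \<partial>M) - (\<integral>\<omega>. h (Z0 \<omega>) \<partial>N)) < r"
    proof eventually_elim
      case (elim n)
      have "\<bar>(\<integral>\<omega>. h (Z n \<omega>) \<partial>M) - (\<integral>\<omega>. g (Z n \<omega>) \<partial>M)\<bar> \<le> (2 * B + 2) * e"
        using M.expectation_diff_le_of_ball[where L=L and K="2 * B + 1", OF Z int(1)[OF h(1) B] int(1)[OF gc g(3)] g(2) bound _ elim(1)]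
          \<open>0 \<le> B\<close> by (simp add: L_def algebra_simps)
      with elim(2) cN have "\<bar>(\<integral>\<omega>. h (Z n \<omega>) \<partial>M) - (\<integral>\<omega>. h (Z0 \<omega>) \<partial>N)\<bar> < (4 * B + 5) * e"
        by (simp add: algebra_simps abs_if split: if_splits)
      also have "\<dots> \<le> r" using \<open>(4 * (B + 2)) * e \<le> r\<close> e(1) by (simp add: algebra_simps)
      finally show ?case by simp
    qed
    then show "\<exists>no. \<forall>n\<ge>no. norm ((\<integral>\<omega>. h (Z n \<omega>) \<partial>M) - (\<integral>\<omega>. h (Z0 \<omega>) \<partial>N)) < r"
      by (simp add: eventually_sequentially)
  qed
qed

section \<open>Limit theorems for independent variables\<close>

text \<open>Cross terms vanish by independence and zero means. Integrability is carried along
  because the induction step for the expectation uses it.\<close>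

lemma (in prob_space) second_moment_sum_indep:
  fixes Y :: "nat \<Rightarrow> 'a \<Rightarrow> real"
  assumes ind: "indep_vars (\<lambda>_. borel) Y UNIV"
    and sq: "\<And>i. integrable M (\<lambda>\<omega>. (Y i \<omega>)\<^sup>2)" and mean: "\<And>i. expectation (Y i) = 0"
  shows "integrable M (\<lambda>\<omega>. (\<Sum>i<n. Y i \<omega>)\<^sup>2)
    \<and> expectation (\<lambda>\<omega>. (\<Sum>i<n. Y i \<omega>)\<^sup>2) = (\<Sum>i<n. expectation (\<lambda>\<omega>. (Y i \<omega>)\<^sup>2))"
proof (induction n)
  case (Suc n)
  have [measurable]: "Y i \<in> borel_measurable M" for i
    using ind unfolding indep_vars_def2 by simp
  have int: "integrable M (Y i)" for i
    by (rule square_integrable_imp_integrable[OF _ sq]) simp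
  have "indep_var borel (Y n) borel (\<lambda>\<omega>. \<Sum>i<n. Y i \<omega>)"
    by (rule indep_vars_sum[OF _ _ indep_vars_subset[OF ind]]) auto
  from indep_var_integrable[OF this] indep_var_lebesgue_integral[OF this]
  have cross: "integrable M (\<lambda>\<omega>. Y n \<omega> * (\<Sum>i<n. Y i \<omega>))"
    "expectation (\<lambda>\<omega>. Y n \<omega> * (\<Sum>i<n. Y i \<omega>)) = 0"
    using int mean by auto
  have eq: "(\<lambda>\<omega>. (\<Sum>i<Suc n. Y i \<omega>)\<^sup>2)
      = (\<lambda>\<omega>. (\<Sum>i<n. Y i \<omega>)\<^sup>2 + (Y n \<omega>)\<^sup>2 + 2 * (Y n \<omega> * (\<Sum>i<n. Y i \<omega>)))"
    by (simp add: power2_sum mult_ac)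
  show ?case
    unfolding eq using Suc cross sq by simp
qed simp

lemma (in prob_space) expectation_abs_le_second_moment:
  assumes "integrable M Z" "integrable M (\<lambda>\<omega>. (Z \<omega>)\<^sup>2)" "0 < (r::real)"
  shows "expectation (\<lambda>\<omega>. \<bar>Z \<omega>\<bar>) \<le> r + expectation (\<lambda>\<omega>. (Z \<omega>)\<^sup>2) / r"
proof -
  have "\<bar>z\<bar> \<le> r + z\<^sup>2 / r" for z :: real
  proof (cases "\<bar>z\<bar> \<le> r")
    case False
    then have "r * \<bar>z\<bar> \<le> z\<^sup>2"
      using \<open>0 < r\<close> mult_right_mono[of r "\<bar>z\<bar>" "\<bar>z\<bar>"] by (simp add: power2_eq_square)
    then have "\<bar>z\<bar> \<le> z\<^sup>2 / r" using \<open>0 < r\<close> by (simp add: pos_le_divide_eq mult.commute)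
    then show ?thesis using \<open>0 < r\<close> by simp
  qed (use \<open>0 < r\<close> in \<open>simp add: add_increasing2\<close>)
  then have "expectation (\<lambda>\<omega>. \<bar>Z \<omega>\<bar>) \<le> expectation (\<lambda>\<omega>. r + (Z \<omega>)\<^sup>2 / r)"
    using assms by (intro integral_mono) auto
  then show ?thesis using assms by (simp add: prob_space)
qed

lemma (in prob_space) expectation_eq_of_distr_eq:
  fixes g :: "'c::topological_space \<Rightarrow> real"
  assumes "distr M borel Y = distr M borel Y'"
    and [measurable]: "Y \<in> borel_measurable M" "Y' \<in> borel_measurable M" "g \<in> borel_measurable borel"
  shows "expectation (\<lambda>\<omega>. g (Y \<omega>)) = expectation (\<lambda>\<omega>. g (Y' \<omega>))"
  using integral_distr[of Y M borel g] integral_distr[of Y' M borel g] assms by simp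

text \<open>Only first moments are assumed, as the products of design components need not be square
  integrable. Truncation at a level \<open>K\<close> makes the centred variables bounded, so their
  average is small in second moment, while the truncation error is small in mean uniformly in the
  index.\<close>

lemma (in prob_space) L1_law_of_large_numbers:
  fixes Y :: "nat \<Rightarrow> 'a \<Rightarrow> real"
  assumes ind: "indep_vars (\<lambda>_. borel) Y UNIV"
    and dist: "\<And>i. distr M borel (Y i) = distr M borel (Y 0)"
    and int: "\<And>i. integrable M (Y i)"
  shows "(\<lambda>n. expectation (\<lambda>\<omega>. \<bar>(\<Sum>i<n. Y i \<omega>) / n - expectation (Y 0)\<bar>)) \<longlonglongrightarrow> 0"
proof -
  have Y [measurable]: "Y i \<in> borel_measurable M" for i
    using ind unfolding indep_vars_def2 by simp
  define T :: "real \<Rightarrow> real \<Rightarrow> real" where "T K x = (if \<bar>x\<bar> \<le> K then x else 0)" for K x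
  have [measurable]: "T K \<in> borel_measurable borel" for K
    unfolding T_def by measurable
  have T_le: "\<bar>T K x\<bar> \<le> \<bar>x\<bar>" for K x by (simp add: T_def)
  have T_K: "\<bar>T K x\<bar> \<le> K" if "0 \<le> K" for K x using that by (simp add: T_def)
  have intT: "integrable M (\<lambda>\<omega>. T K (Y i \<omega>))" for K i
    by (rule Bochner_Integration.integrable_bound[OF int[of i]]) (use T_le in auto)
  have trunc: "(\<lambda>k. expectation (\<lambda>\<omega>. \<bar>Y 0 \<omega> - T (real k) (Y 0 \<omega>)\<bar>)) \<longlonglongrightarrow> expectation (\<lambda>\<omega>. 0)"
  proof (rule integral_dominated_convergence[where w="\<lambda>\<omega>. \<bar>Y 0 \<omega>\<bar>"])
    have "(\<lambda>k. \<bar>y - T (real k) y\<bar>) \<longlonglongrightarrow> 0" for y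
    proof (rule tendsto_eventually)
      obtain k where "\<bar>y\<bar> \<le> real k" using real_arch_simple by blast
      then show "\<forall>\<^sub>F k in sequentially. \<bar>y - T (real k) y\<bar> = 0"
        by (intro eventually_sequentiallyI[of k]) (auto simp: T_def)
    qed
    then show "AE \<omega> in M. (\<lambda>k. \<bar>Y 0 \<omega> - T (real k) (Y 0 \<omega>)\<bar>) \<longlonglongrightarrow> 0" by simp
    show "AE \<omega> in M. norm \<bar>Y 0 \<omega> - T (real k) (Y 0 \<omega>)\<bar> \<le> \<bar>Y 0 \<omega>\<bar>" for k
      by (intro AE_I2) (simp add: T_def)
  qed (use int in auto)
  show ?thesis
  proof (rule LIMSEQ_I)
    fix r :: real assume "0 < r"
    define e where "e = r / 4"
    have "0 < e" using \<open>0 < r\<close> by (simp add: e_def)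
    from order_tendstoD(2)[OF trunc, of e] this
    obtain k where k: "expectation (\<lambda>\<omega>. \<bar>Y 0 \<omega> - T (real k) (Y 0 \<omega>)\<bar>) < e"
      by (auto simp: eventually_sequentially)
    define K where "K = real k"
    define m where "m = expectation (\<lambda>\<omega>. T K (Y 0 \<omega>))"
    define D where "D i \<omega> = T K (Y i \<omega>) - m" for i \<omega>
    have [measurable]: "D i \<in> borel_measurable M" for i unfolding D_def by measurable
    have mK: "\<bar>m\<bar> \<le> K"
    proof -
      have "\<bar>m\<bar> \<le> expectation (\<lambda>\<omega>. \<bar>T K (Y 0 \<omega>)\<bar>)" unfolding m_def by (rule integral_abs_bound)
      also have "\<dots> \<le> expectation (\<lambda>\<omega>. K)"
        using T_K[of K] intT by (intro integral_mono) (auto simp: K_def)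
      finally show ?thesis by (simp add: prob_space)
    qed
    have D2K: "\<bar>D i \<omega>\<bar> \<le> 2 * K" for i \<omega>
      using T_K[of K "Y i \<omega>"] mK by (simp add: D_def K_def abs_le_iff)
    have D_sq: "(D i \<omega>)\<^sup>2 \<le> (2 * K)\<^sup>2" for i \<omega>
      using D2K[of i \<omega>] power_mono[of "\<bar>D i \<omega>\<bar>" "2 * K" 2] by simp
    have indD: "indep_vars (\<lambda>_. borel) D UNIV"
      using indep_vars_compose2[OF ind, of "\<lambda>_ x. T K x - m" "\<lambda>_. borel"] unfolding D_def[abs_def] by simp
    have intD: "integrable M (\<lambda>\<omega>. (D i \<omega>)\<^sup>2)" for i
      by (rule integrable_bounded[where K="(2 * K)\<^sup>2"]) (use D_sq in auto)
    have meanD: "expectation (D i) = 0" for i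
    proof -
      have "expectation (\<lambda>\<omega>. T K (Y i \<omega>)) = m"
        unfolding m_def by (rule expectation_eq_of_distr_eq[OF dist]) auto
      then show ?thesis unfolding D_def using intT by (simp add: prob_space)
    qed
    note sm = second_moment_sum_indep[OF indD intD meanD]
    \<comment> \<open>One \<open>e\<close> each comes from truncating the summands, from truncating
      the mean, and from the passage from second to first moment. The variance term falls below the
      fourth \<open>e\<close> for large \<open>n\<close>.\<close>
    have main: "expectation (\<lambda>\<omega>. \<bar>(\<Sum>i<n. Y i \<omega>) / n - expectation (Y 0)\<bar>) \<le> 3 * e + (2 * K)\<^sup>2 / e / n"
      if "1 \<le> n" for n
    proof -
      define Z where "Z \<omega> = (\<Sum>i<n. D i \<omega>) / n" for \<omega>
      have intDi: "integrable M (D i)" for i unfolding D_def using intT by simp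
      have "integrable M Z" unfolding Z_def using intDi by simp
      have Z2: "(\<lambda>\<omega>. (Z \<omega>)\<^sup>2) = (\<lambda>\<omega>. (\<Sum>i<n. D i \<omega>)\<^sup>2 / n\<^sup>2)"
        by (simp add: Z_def power_divide)
      have "expectation (\<lambda>\<omega>. (Z \<omega>)\<^sup>2) = (\<Sum>i<n. expectation (\<lambda>\<omega>. (D i \<omega>)\<^sup>2)) / n\<^sup>2"
        unfolding Z2 using sm[of n] by simp
      also have "(\<Sum>i<n. expectation (\<lambda>\<omega>. (D i \<omega>)\<^sup>2)) \<le> (\<Sum>i<n. (2 * K)\<^sup>2)"
      proof (rule sum_mono)
        fix i
        have "expectation (\<lambda>\<omega>. (D i \<omega>)\<^sup>2) \<le> expectation (\<lambda>\<omega>. (2 * K)\<^sup>2)"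
          using intD D_sq by (intro integral_mono) auto
        then show "expectation (\<lambda>\<omega>. (D i \<omega>)\<^sup>2) \<le> (2 * K)\<^sup>2" by (simp add: prob_space)
      qed
      finally have varZ: "expectation (\<lambda>\<omega>. (Z \<omega>)\<^sup>2) \<le> (2 * K)\<^sup>2 / n"
        using that by (simp add: divide_right_mono power2_eq_square[of "real n"])
      have "integrable M (\<lambda>\<omega>. (Z \<omega>)\<^sup>2)" unfolding Z2 using sm[of n] by simp
      from expectation_abs_le_second_moment[OF \<open>integrable M Z\<close> this \<open>0 < e\<close>]
      have Zle: "expectation (\<lambda>\<omega>. \<bar>Z \<omega>\<bar>) \<le> e + (2 * K)\<^sup>2 / e / n"
        using divide_right_mono[OF varZ, of e] \<open>0 < e\<close> by (simp add: mult.commute)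
      have tr: "expectation (\<lambda>\<omega>. \<bar>Y i \<omega> - T K (Y i \<omega>)\<bar>) \<le> e" for i
        using k expectation_eq_of_distr_eq[OF dist[of i], of "\<lambda>x. \<bar>x - T K x\<bar>"] by (simp add: K_def)
      have "\<bar>m - expectation (Y 0)\<bar> = \<bar>expectation (\<lambda>\<omega>. T K (Y 0 \<omega>) - Y 0 \<omega>)\<bar>"
        unfolding m_def using int intT by simp
      also have "\<dots> \<le> expectation (\<lambda>\<omega>. \<bar>T K (Y 0 \<omega>) - Y 0 \<omega>\<bar>)" by (rule integral_abs_bound)
      also have "\<dots> \<le> e" using tr[of 0] by (simp add: abs_minus_commute)
      finally have mm: "\<bar>m - expectation (Y 0)\<bar> \<le> e" .
      have pt: "\<bar>(\<Sum>i<n. Y i \<omega>) / n - expectation (Y 0)\<bar>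
          \<le> (\<Sum>i<n. \<bar>Y i \<omega> - T K (Y i \<omega>)\<bar>) / n + \<bar>Z \<omega>\<bar> + e" for \<omega>
      proof -
        have "(\<Sum>i<n. Y i \<omega>) / n - expectation (Y 0)
            = (\<Sum>i<n. Y i \<omega> - T K (Y i \<omega>)) / n + Z \<omega> + (m - expectation (Y 0))"
          using that by (simp add: Z_def D_def sum_subtractf diff_divide_distrib)
        moreover have "\<bar>(\<Sum>i<n. Y i \<omega> - T K (Y i \<omega>)) / n\<bar> \<le> (\<Sum>i<n. \<bar>Y i \<omega> - T K (Y i \<omega>)\<bar>) / n"
          unfolding abs_divide using sum_abs by (auto intro!: divide_right_mono)
        ultimately show ?thesis using mm by linarith
      qed
      have "expectation (\<lambda>\<omega>. \<bar>(\<Sum>i<n. Y i \<omega>) / n - expectation (Y 0)\<bar>)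
          \<le> expectation (\<lambda>\<omega>. (\<Sum>i<n. \<bar>Y i \<omega> - T K (Y i \<omega>)\<bar>) / n + \<bar>Z \<omega>\<bar> + e)"
        using int intT \<open>integrable M Z\<close> pt by (intro integral_mono) auto
      also have "\<dots> = (\<Sum>i<n. expectation (\<lambda>\<omega>. \<bar>Y i \<omega> - T K (Y i \<omega>)\<bar>)) / n + expectation (\<lambda>\<omega>. \<bar>Z \<omega>\<bar>) + e"
        using int intT \<open>integrable M Z\<close> by (simp add: prob_space)
      also have "(\<Sum>i<n. expectation (\<lambda>\<omega>. \<bar>Y i \<omega> - T K (Y i \<omega>)\<bar>)) \<le> (\<Sum>i<n. e)"
        by (intro sum_mono tr)
      also have "(\<Sum>i<n. e) / n = e" using that by simp
      finally show ?thesis using Zle by (simp add: divide_right_mono)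
    qed
    have "(\<lambda>n. (2 * K)\<^sup>2 / e / real n) \<longlonglongrightarrow> 0"
      by (intro lim_const_over_n)
    then have "\<forall>\<^sub>F n in sequentially. (2 * K)\<^sup>2 / e / real n < e"
      using \<open>0 < e\<close> by (rule order_tendstoD)
    with eventually_ge_at_top[of "1::nat"]
    have "\<forall>\<^sub>F n in sequentially. norm (expectation (\<lambda>\<omega>. \<bar>(\<Sum>i<n. Y i \<omega>) / n - expectation (Y 0)\<bar>) - 0) < r"
    proof eventually_elim
      case (elim n)
      have "0 \<le> expectation (\<lambda>\<omega>. \<bar>(\<Sum>i<n. Y i \<omega>) / n - expectation (Y 0)\<bar>)" by simp
      then show ?case using main[OF elim(1)] elim(2) by (simp add: e_def)
    qed
    then show "\<exists>no. \<forall>n\<ge>no. norm (expectation (\<lambda>\<omega>. \<bar>(\<Sum>i<n. Y i \<omega>) / n - expectation (Y 0)\<bar>) - 0) < r"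
      by (simp add: eventually_sequentially)
  qed
qed

section \<open>The one-dimensional central limit theorem\<close>

lemma integral_normal_law_scale:
  fixes g :: "real \<Rightarrow> real"
  assumes [measurable]: "g \<in> borel_measurable borel" and "0 < v"
  shows "(\<integral>x. g (sqrt v * x) \<partial>std_normal_distribution) = (\<integral>x. g x \<partial>normal_law 0 v)"
proof -
  interpret real_distribution std_normal_distribution by (rule real_dist_normal_dist)
  have "distributed std_normal_distribution lborel (\<lambda>x. x) std_normal_density"
    unfolding distributed_def by (auto simp: distr_id2)
  from normal_density_affine[OF this, of "sqrt v" 0]
  have "distributed std_normal_distribution lborel (\<lambda>x. sqrt v * x) (normal_density 0 (sqrt v))"
    using \<open>0 < v\<close> by simp
  then have "distr std_normal_distribution lborel (\<lambda>x. sqrt v * x) = normal_law 0 v"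
    using \<open>0 < v\<close> by (simp add: distributed_def normal_law_def)
  then show ?thesis
    using integral_distr[of "\<lambda>x. sqrt v * x" std_normal_distribution lborel g] by simp
qed

text \<open>Standardizing divides by \<open>sqrt v\<close>, so \<open>v = 0\<close> is treated
  apart: all summands vanish almost surely and the limit law is the point mass at 0.\<close>

lemma (in prob_space) central_limit_theorem_normal_law:
  fixes Y :: "nat \<Rightarrow> 'a \<Rightarrow> real" and g :: "real \<Rightarrow> real"
  assumes ind: "indep_vars (\<lambda>_. borel) Y UNIV"
    and dist: "\<And>i. distr M borel (Y i) = distr M borel (Y 0)"
    and sq: "\<And>i. integrable M (\<lambda>\<omega>. (Y i \<omega>)\<^sup>2)"
    and mean: "\<And>i. expectation (Y i) = 0"
    and var: "\<And>i. expectation (\<lambda>\<omega>. (Y i \<omega>)\<^sup>2) = v"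
    and g: "continuous_on UNIV g" and B: "\<And>x. \<bar>g x\<bar> \<le> B"
  shows "(\<lambda>n. expectation (\<lambda>\<omega>. g (1 / sqrt n * (\<Sum>i<n. Y i \<omega>)))) \<longlonglongrightarrow> (\<integral>x. g x \<partial>normal_law 0 v)"
proof -
  have [measurable]: "Y i \<in> borel_measurable M" for i
    using ind unfolding indep_vars_def2 by simp
  have [measurable]: "g \<in> borel_measurable borel" using g by (rule borel_measurable_continuous_onI)
  have "0 \<le> expectation (\<lambda>\<omega>. (Y 0 \<omega>)\<^sup>2)" by simp
  then consider "v = 0" | "0 < v" using var[of 0] by (auto simp: less_le)
  then show ?thesis
  proof cases
    case 1
    have "AE \<omega> in M. (Y i \<omega>)\<^sup>2 = 0" for i
      using integral_nonneg_eq_0_iff_AE[OF sq[of i]] var[of i] 1 by simp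
    then have "AE \<omega> in M. \<forall>i. Y i \<omega> = 0" by (simp add: AE_all_countable)
    then have "AE \<omega> in M. g (1 / sqrt n * (\<Sum>i<n. Y i \<omega>)) = g 0" for n
      by (rule eventually_mono) simp
    then have "expectation (\<lambda>\<omega>. g (1 / sqrt n * (\<Sum>i<n. Y i \<omega>))) = expectation (\<lambda>\<omega>. g 0)" for n
      by (intro integral_cong_AE) auto
    moreover have "(\<integral>x. g x \<partial>normal_law 0 v) = g 0"
      using 1 by (simp add: normal_law_def integral_return)
    ultimately show ?thesis by (simp add: prob_space)
  next
    case 2
    have wc: "weak_conv_m (\<lambda>n. distr M borel (\<lambda>x. (\<Sum>i<n. Y i x) / sqrt (n * (sqrt v)\<^sup>2))) std_normal_distribution"
      using 2 mean var by (intro central_limit_theorem_zero_mean[OF ind mean _ sq _ dist]) auto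
    \<comment> \<open>Testing with \<open>g (sqrt v * x)\<close> undoes the standardization.\<close>
    have conv: "(\<lambda>n. \<integral>x. g (sqrt v * x) \<partial>distr M borel (\<lambda>x. (\<Sum>i<n. Y i x) / sqrt (n * (sqrt v)\<^sup>2)))
        \<longlonglongrightarrow> (\<integral>x. g (sqrt v * x) \<partial>std_normal_distribution)"
    proof (rule weak_conv_imp_integral_bdd_continuous_conv[OF _ real_dist_normal_dist wc])
      show "real_distribution (distr M borel (\<lambda>x. (\<Sum>i<n. Y i x) / sqrt (n * (sqrt v)\<^sup>2)))" for n
        by (rule real_distribution_distr) simp
      have "continuous_on UNIV (\<lambda>x. g (sqrt v * x))"
        by (rule continuous_on_compose2[OF g]) (auto intro: continuous_intros)
      then show "isCont (\<lambda>x. g (sqrt v * x)) x" for x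
        by (simp add: continuous_on_eq_continuous_at)
      show "norm (g (sqrt v * x)) \<le> B" for x using B by simp
    qed
    have "(\<integral>x. g (sqrt v * x) \<partial>distr M borel (\<lambda>x. (\<Sum>i<n. Y i x) / sqrt (n * (sqrt v)\<^sup>2)))
        = expectation (\<lambda>\<omega>. g (1 / sqrt n * (\<Sum>i<n. Y i \<omega>)))" for n
      using 2 by (subst integral_distr) (simp_all add: real_sqrt_mult)
    with conv integral_normal_law_scale[of g v] 2 show ?thesis by simp
  qed
qed

section \<open>Products taken across two independent sequences\<close>

lemma (in prob_space) indep_var_of_indep_set:
  assumes A: "space A = space M" and B: "space B = space M" and ind: "indep_set (sets A) (sets B)"
    and U: "U \<in> measurable A borel" and V: "V \<in> measurable B borel"
  shows "indep_var borel U borel V"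
proof -
  have "sets A \<subseteq> events" "sets B \<subseteq> events"
    using indep_setD_ev1[OF ind] indep_setD_ev2[OF ind] .
  then have "U \<in> measurable M borel" "V \<in> measurable M borel"
    using measurable_mono[of borel borel A M] measurable_mono[of borel borel B M] U V A B by auto
  moreover have "sigma_sets (space M) {U -` E \<inter> space M |E. E \<in> sets borel} \<subseteq> sets A"
    unfolding A[symmetric] by (rule sets.sigma_sets_subset) (auto intro: measurable_sets[OF U])
  moreover have "sigma_sets (space M) {V -` E \<inter> space M |E. E \<in> sets borel} \<subseteq> sets B"
    unfolding B[symmetric] by (rule sets.sigma_sets_subset) (auto intro: measurable_sets[OF V])
  ultimately show ?thesis
    using ind unfolding indep_var_eq indep_sets2_eq by (meson subset_iff)
qed

text \<open>Both sequences are merged into one independent family: a finite product of probabilities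
  factors across the sequences by independence of the two algebras, and within each sequence by its
  own independence. Grouping the merged family into pairs then gives the products.\<close>

lemma (in prob_space) indep_vars_pairing:
  fixes U V :: "nat \<Rightarrow> 'a \<Rightarrow> real"
  assumes A: "space A = space M" and B: "space B = space M" and ind: "indep_set (sets A) (sets B)"
    and U: "\<And>i. U i \<in> borel_measurable A" and V: "\<And>i. V i \<in> borel_measurable B"
    and indU: "indep_vars (\<lambda>_. borel) U UNIV" and indV: "indep_vars (\<lambda>_. borel) V UNIV"
  shows "indep_vars (\<lambda>_. borel) (\<lambda>i \<omega>. U i \<omega> * V i \<omega>) UNIV"
proof -
  define Z where "Z j = (if fst j then U (snd j) else V (snd j))" for j :: "bool \<times> nat"
  have rv: "random_variable borel (Z j)" for j
    using indU indV by (auto simp: Z_def indep_vars_def2)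
  have "indep_vars (\<lambda>_. borel) Z UNIV"
    unfolding indep_vars_def2
  proof (intro conjI ballI rv indep_setsI)
    fix j show "{Z j -` E \<inter> space M |E. E \<in> sets borel} \<subseteq> events"
      by (auto intro: measurable_sets[OF rv])
  next
    fix E and J :: "(bool \<times> nat) set"
    assume J: "J \<noteq> {}" "finite J" and "\<forall>j\<in>J. E j \<in> {Z j -` E \<inter> space M |E. E \<in> sets borel}"
    then have "\<forall>j\<in>J. \<exists>F. F \<in> sets borel \<and> E j = Z j -` F \<inter> space M" by auto
    then obtain F where F: "\<And>j. j \<in> J \<Longrightarrow> F j \<in> sets borel" "\<And>j. j \<in> J \<Longrightarrow> E j = Z j -` F j \<inter> space M"
      by metis
    define J1 J2 where "J1 = {i. (True, i) \<in> J}" and "J2 = {i. (False, i) \<in> J}"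
    have "(b, i) \<in> J \<longleftrightarrow> (b, i) \<in> Pair True ` J1 \<union> Pair False ` J2" for b i
      by (cases b) (auto simp: J1_def J2_def)
    then have Jeq: "J = Pair True ` J1 \<union> Pair False ` J2" by auto
    have disj: "Pair True ` J1 \<inter> Pair False ` J2 = {}" by auto
    have fin: "finite J1" "finite J2"
      using \<open>finite J\<close> unfolding Jeq by (auto dest: finite_imageD simp: inj_on_def)
    \<comment> \<open>The intersection with \<open>space M\<close> gives the right event when no
      index of this kind occurs in \<open>J\<close>.\<close>
    define P1 where "P1 = space M \<inter> (\<Inter>i\<in>J1. U i -` F (True, i) \<inter> space M)"
    define P2 where "P2 = space M \<inter> (\<Inter>i\<in>J2. V i -` F (False, i) \<inter> space M)"
    have "P1 \<in> sets A"
    proof (cases "J1 = {}")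
      case True then show ?thesis using sets.top[of A] by (simp add: P1_def A)
    next
      case False
      have "U i -` F (True, i) \<inter> space A \<in> sets A" if "i \<in> J1" for i
        using that F(1) U by (intro measurable_sets) (auto simp: J1_def)
      then show ?thesis unfolding P1_def A[symmetric] using fin False
        by (intro sets.Int[OF sets.top sets.finite_INT]) auto
    qed
    have "P2 \<in> sets B"
    proof (cases "J2 = {}")
      case True then show ?thesis using sets.top[of B] by (simp add: P2_def B)
    next
      case False
      have "V i -` F (False, i) \<inter> space B \<in> sets B" if "i \<in> J2" for i
        using that F(1) V by (intro measurable_sets) (auto simp: J2_def)
      then show ?thesis unfolding P2_def B[symmetric] using fin False
        by (intro sets.Int[OF sets.top sets.finite_INT]) auto
    qed
    have p1: "prob P1 = (\<Prod>i\<in>J1. prob (E (True, i)))"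
    proof (cases "J1 = {}")
      case False
      have "P1 = (\<Inter>i\<in>J1. U i -` F (True, i) \<inter> space M)" using False by (auto simp: P1_def)
      also have "prob \<dots> = (\<Prod>i\<in>J1. prob (U i -` F (True, i) \<inter> space M))"
        using F(1) by (intro indep_varsD[OF indU False fin(1)]) (auto simp: J1_def)
      finally show ?thesis using F(2) by (simp add: J1_def Z_def)
    qed (simp add: P1_def prob_space)
    have p2: "prob P2 = (\<Prod>i\<in>J2. prob (E (False, i)))"
    proof (cases "J2 = {}")
      case False
      have "P2 = (\<Inter>i\<in>J2. V i -` F (False, i) \<inter> space M)" using False by (auto simp: P2_def)
      also have "prob \<dots> = (\<Prod>i\<in>J2. prob (V i -` F (False, i) \<inter> space M))"
        using F(1) by (intro indep_varsD[OF indV False fin(2)]) (auto simp: J2_def)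
      finally show ?thesis using F(2) by (simp add: J2_def Z_def)
    qed (simp add: P2_def prob_space)
    have "E j \<subseteq> space M" if "j \<in> J" for j using F(2)[OF that] by auto
    then have "(\<Inter>j\<in>J. E j) = space M \<inter> (\<Inter>j\<in>J. E j)" using J by auto
    also have "\<dots> = (space M \<inter> (\<Inter>i\<in>J1. E (True, i))) \<inter> (space M \<inter> (\<Inter>i\<in>J2. E (False, i)))"
      unfolding Jeq by auto
    also have "\<dots> = P1 \<inter> P2"
      unfolding P1_def P2_def using F(2) by (simp add: J1_def J2_def Z_def)
    finally have "prob (\<Inter>j\<in>J. E j) = prob P1 * prob P2"
      using indep_setD[OF ind \<open>P1 \<in> sets A\<close> \<open>P2 \<in> sets B\<close>] by simp
    also have "\<dots> = (\<Prod>j\<in>Pair True ` J1 \<union> Pair False ` J2. prob (E j))"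
      unfolding p1 p2 using fin disj by (simp add: prod.union_disjoint prod.reindex inj_on_def)
    finally show "prob (\<Inter>j\<in>J. E j) = (\<Prod>j\<in>J. prob (E j))" unfolding Jeq .
  qed
  \<comment> \<open>The pairs with different \<open>i\<close> are disjoint blocks of indices, hence
    independent, and multiplication is measurable on each block.\<close>
  from indep_vars_restrict[OF this, of UNIV "\<lambda>i. {(True, i), (False, i)}"]
  have "indep_vars (\<lambda>i. PiM {(True, i), (False, i)} (\<lambda>_. borel))
      (\<lambda>i \<omega>. restrict (\<lambda>j. Z j \<omega>) {(True, i), (False, i)}) UNIV"
    by (simp add: disjoint_family_on_def)
  from indep_vars_compose2[OF this, of "\<lambda>i w. w (True, i) * w (False, i)" "\<lambda>_. borel"]
  show ?thesis by (simp add: Z_def)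
qed

section \<open>The linear model\<close>

text \<open>Collects the assumptions on design and errors only; the true parameter, the response and
  the penalty enter in the final lemma of the locale.\<close>

locale linear_model = prob_space +
  fixes X :: "nat \<Rightarrow> 'a \<Rightarrow> real^'p" and \<epsilon> :: "nat \<Rightarrow> 'a \<Rightarrow> real" and C :: "real^'p^'p" and \<sigma> :: real
  assumes X_indep: "indep_vars (\<lambda>_. borel) X UNIV"
    and X_distr: "\<And>i. distr M borel (X i) = distr M borel (X 0)"
    and X_sq: "\<And>i. integrable M (\<lambda>\<omega>. (norm (X i \<omega>))\<^sup>2)"
    and X_mean: "\<And>i. (\<integral>\<omega>. X i \<omega> \<partial>M) = 0"
    and X_cov: "\<And>i. covariance_matrix M (X i) = C"
    and eps_indep: "indep_vars (\<lambda>_. borel) \<epsilon> UNIV"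
    and eps_distr: "\<And>i. distr M borel (\<epsilon> i) = distr M borel (\<epsilon> 0)"
    and eps_sq: "\<And>i. integrable M (\<lambda>\<omega>. (\<epsilon> i \<omega>)\<^sup>2)"
    and eps_mean: "\<And>i. expectation (\<epsilon> i) = 0"
    and eps_var: "\<And>i. variance (\<epsilon> i) = \<sigma>\<^sup>2"
    and X_eps_indep: "indep_set
      (sets (vimage_algebra (space M) (\<lambda>\<omega> i. X i \<omega>) (\<Pi>\<^sub>M i\<in>(UNIV::nat set). borel)))
      (sets (vimage_algebra (space M) (\<lambda>\<omega> i. \<epsilon> i \<omega>) (\<Pi>\<^sub>M i\<in>(UNIV::nat set). borel)))"
begin

lemma X_measurable [measurable]: "X i \<in> borel_measurable M"
  using X_indep unfolding indep_vars_def2 by simp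

lemma X_component_measurable [measurable]: "(\<lambda>\<omega>. X i \<omega> $ j) \<in> borel_measurable M"
proof -
  have "(\<lambda>x::real^'p. x $ j) \<in> borel_measurable borel"
    by (intro borel_measurable_continuous_onI continuous_intros)
  from measurable_compose[OF X_measurable this] show ?thesis .
qed

lemma eps_measurable [measurable]: "\<epsilon> i \<in> borel_measurable M"
  using eps_indep unfolding indep_vars_def2 by simp

lemma X_integrable: "integrable M (X i)"
proof -
  have "integrable M (\<lambda>\<omega>. norm (X i \<omega>))"
    by (rule square_integrable_imp_integrable[OF _ X_sq]) simp
  then show ?thesis by (subst (asm) integrable_norm_iff) auto
qed

lemma eps_integrable: "integrable M (\<epsilon> i)"
  by (rule square_integrable_imp_integrable[OF _ eps_sq]) simp

lemma X_component_mean: "expectation (\<lambda>\<omega>. X i \<omega> $ j) = 0"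
  using integral_bounded_linear[OF bounded_linear_vec_nth X_integrable] X_mean by simp

lemma X_product_integrable: "integrable M (\<lambda>\<omega>. X i \<omega> $ j * X i \<omega> $ k)"
proof (rule Bochner_Integration.integrable_bound[OF X_sq[of i]])
  have "\<bar>x $ j * x $ k\<bar> \<le> (norm x)\<^sup>2" for x :: "real^'p"
    unfolding abs_mult power2_eq_square by (intro mult_mono component_le_norm_cart) auto
  then show "AE \<omega> in M. norm (X i \<omega> $ j * X i \<omega> $ k) \<le> norm ((norm (X i \<omega>))\<^sup>2)" by simp
qed measurable

lemma X_product_mean: "expectation (\<lambda>\<omega>. X i \<omega> $ j * X i \<omega> $ k) = C $ j $ k"
  using X_cov[of i] by (auto simp: covariance_matrix_def X_component_mean)

lemma inner_X_sq:
  "integrable M (\<lambda>\<omega>. (t \<bullet> X i \<omega>)\<^sup>2)" "expectation (\<lambda>\<omega>. (t \<bullet> X i \<omega>)\<^sup>2) = t \<bullet> (C *v t)"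
proof -
  have eq: "(\<lambda>\<omega>. (t \<bullet> X i \<omega>)\<^sup>2)
      = (\<lambda>\<omega>. \<Sum>j\<in>UNIV. \<Sum>k\<in>UNIV. t $ j * t $ k * (X i \<omega> $ j * X i \<omega> $ k))"
    by (simp add: inner_vec_def power2_eq_square sum_product mult_ac)
  show "integrable M (\<lambda>\<omega>. (t \<bullet> X i \<omega>)\<^sup>2)"
    unfolding eq using X_product_integrable by simp
  have "expectation (\<lambda>\<omega>. (t \<bullet> X i \<omega>)\<^sup>2) = (\<Sum>j\<in>UNIV. \<Sum>k\<in>UNIV. t $ j * t $ k * C $ j $ k)"
    unfolding eq using X_product_integrable by (simp add: X_product_mean)
  also have "\<dots> = t \<bullet> (C *v t)"
    by (simp add: inner_vec_def matrix_vector_mult_def sum_distrib_left mult_ac)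
  finally show "expectation (\<lambda>\<omega>. (t \<bullet> X i \<omega>)\<^sup>2) = t \<bullet> (C *v t)" .
qed

lemma eps_sq_mean: "expectation (\<lambda>\<omega>. (\<epsilon> i \<omega>)\<^sup>2) = \<sigma>\<^sup>2"
  using eps_var[of i] by (simp add: eps_mean)

definition X_algebra where "X_algebra = vimage_algebra (space M) (\<lambda>\<omega> i. X i \<omega>) (\<Pi>\<^sub>M i\<in>(UNIV::nat set). borel)"
definition eps_algebra where "eps_algebra = vimage_algebra (space M) (\<lambda>\<omega> i. \<epsilon> i \<omega>) (\<Pi>\<^sub>M i\<in>(UNIV::nat set). borel)"

lemma space_algebras: "space X_algebra = space M" "space eps_algebra = space M"
  by (simp_all add: X_algebra_def eps_algebra_def)

lemma X_measurable_algebra [measurable]: "X i \<in> borel_measurable X_algebra"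
proof -
  have "(\<lambda>\<omega> i. X i \<omega>) \<in> measurable X_algebra (\<Pi>\<^sub>M i\<in>(UNIV::nat set). borel)"
    unfolding X_algebra_def by (rule measurable_vimage_algebra1) (simp add: space_PiM)
  from measurable_compose[OF this measurable_component_singleton[of i]] show ?thesis by simp
qed

lemma eps_measurable_algebra [measurable]: "\<epsilon> i \<in> borel_measurable eps_algebra"
proof -
  have "(\<lambda>\<omega> i. \<epsilon> i \<omega>) \<in> measurable eps_algebra (\<Pi>\<^sub>M i\<in>(UNIV::nat set). borel)"
    unfolding eps_algebra_def by (rule measurable_vimage_algebra1) (simp add: space_PiM)
  from measurable_compose[OF this measurable_component_singleton[of i]] show ?thesis by simp
qed

lemmas algebras_indep = X_eps_indep[folded X_algebra_def eps_algebra_def]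

text \<open>The summands of the score in direction \<open>t\<close>: an i.i.d. real sequence to
  which the scalar limit theorem applies.\<close>

definition noise :: "real^'p \<Rightarrow> nat \<Rightarrow> 'a \<Rightarrow> real" where
  "noise t i \<omega> = (t \<bullet> X i \<omega>) * \<epsilon> i \<omega>"

lemma indep_var_inner_X_eps: "indep_var borel (\<lambda>\<omega>. t \<bullet> X i \<omega>) borel (\<epsilon> i)"
  by (rule indep_var_of_indep_set[OF space_algebras algebras_indep]) measurable

lemma noise_indep: "indep_vars (\<lambda>_. borel) (noise t) UNIV"
  unfolding noise_def[abs_def]
proof (rule indep_vars_pairing[OF space_algebras algebras_indep _ _ _ eps_indep])
  show "indep_vars (\<lambda>_. borel) (\<lambda>i \<omega>. t \<bullet> X i \<omega>) UNIV"
    using indep_vars_compose2[OF X_indep, of "\<lambda>_ x. t \<bullet> x" "\<lambda>_. borel"] by simp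
qed measurable

text \<open>By independence the joint law of the two factors is the product of their marginals,
  which do not depend on \<open>i\<close>.\<close>

lemma noise_distr: "distr M borel (noise t i) = distr M borel (noise t 0)"
proof -
  have "distr M borel (\<lambda>\<omega>. t \<bullet> X i \<omega>) = distr (distr M borel (X i)) borel (\<lambda>x. t \<bullet> x)" for i
    by (subst distr_distr) (auto simp: comp_def)
  then have tX: "distr M borel (\<lambda>\<omega>. t \<bullet> X i \<omega>) = distr M borel (\<lambda>\<omega>. t \<bullet> X 0 \<omega>)"
    using X_distr[of i] by simp
  have "distr M borel (noise t i)
      = distr (distr M borel (\<lambda>\<omega>. t \<bullet> X i \<omega>) \<Otimes>\<^sub>M distr M borel (\<epsilon> i)) borel (\<lambda>(a, b). a * b)" for i
  proof -
    have "distr M borel (\<lambda>\<omega>. t \<bullet> X i \<omega>) \<Otimes>\<^sub>M distr M borel (\<epsilon> i)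
        = distr M (borel \<Otimes>\<^sub>M borel) (\<lambda>\<omega>. (t \<bullet> X i \<omega>, \<epsilon> i \<omega>))"
      using indep_var_inner_X_eps[of t i] unfolding indep_var_distribution_eq by blast
    then show ?thesis
      by (simp add: distr_distr comp_def noise_def[abs_def])
  qed
  then show ?thesis using tX eps_distr[of i] by simp
qed

lemma noise_mean: "expectation (noise t i) = 0"
  using indep_var_lebesgue_integral[OF indep_var_inner_X_eps, of t i] X_integrable eps_integrable eps_mean
  by (simp add: noise_def[abs_def])

lemma noise_sq:
  "integrable M (\<lambda>\<omega>. (noise t i \<omega>)\<^sup>2)"
  "expectation (\<lambda>\<omega>. (noise t i \<omega>)\<^sup>2) = t \<bullet> ((\<sigma>\<^sup>2 *\<^sub>R C) *v t)"
proof -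
  have ind: "indep_var borel (\<lambda>\<omega>. (t \<bullet> X i \<omega>)\<^sup>2) borel (\<lambda>\<omega>. (\<epsilon> i \<omega>)\<^sup>2)"
    by (rule indep_var_of_indep_set[OF space_algebras algebras_indep]) measurable
  show "integrable M (\<lambda>\<omega>. (noise t i \<omega>)\<^sup>2)"
    using indep_var_integrable[OF ind inner_X_sq(1) eps_sq] by (simp add: noise_def power_mult_distrib)
  show "expectation (\<lambda>\<omega>. (noise t i \<omega>)\<^sup>2) = t \<bullet> ((\<sigma>\<^sup>2 *\<^sub>R C) *v t)"
    using indep_var_lebesgue_integral[OF ind inner_X_sq(1) eps_sq]
    by (simp add: noise_def power_mult_distrib inner_X_sq eps_sq_mean scaleR_matrix_vector_assoc[symmetric])
qed

section \<open>The normalized score and the Gram error\<close>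

definition S :: "nat \<Rightarrow> 'a \<Rightarrow> real^'p" where
  "S n \<omega> = score n (\<lambda>i. X i \<omega>) (\<lambda>i. \<epsilon> i \<omega>)"

definition gram_error :: "nat \<Rightarrow> 'a \<Rightarrow> real" where
  "gram_error n \<omega> = (\<Sum>j\<in>UNIV. \<Sum>k\<in>UNIV. \<bar>gram n (\<lambda>i. X i \<omega>) $ j $ k - C $ j $ k\<bar>)"

lemma S_measurable [measurable]: "S n \<in> borel_measurable M"
  unfolding S_def score_def by measurable

lemma inner_S: "t \<bullet> S n \<omega> = 1 / sqrt n * (\<Sum>i<n. noise t i \<omega>)"
  by (simp add: S_def score_def noise_def inner_sum_right mult_ac)

text \<open>For every \<open>n \<ge> 1\<close> the second moment of the norm equals the trace
  \<open>c\<close> of \<open>\<sigma>\<^sup>2 *\<^sub>R C\<close>, so Markov's inequality bounds all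
  tails at once.\<close>

lemma S_tight:
  assumes "0 < e"
  shows "\<exists>R. \<forall>\<^sub>F n in sequentially. prob {\<omega>\<in>space M. R < norm (S n \<omega>)} < e"
proof -
  define c where "c = (\<Sum>b\<in>(Basis::(real^'p) set). b \<bullet> ((\<sigma>\<^sup>2 *\<^sub>R C) *v b))"
  have S2: "(norm (S n \<omega>))\<^sup>2 = (\<Sum>b\<in>Basis. (\<Sum>i<n. noise b i \<omega>)\<^sup>2 / n)" for n \<omega>
  proof -
    have "(norm (S n \<omega>))\<^sup>2 = (\<Sum>b\<in>Basis. (b \<bullet> S n \<omega>)\<^sup>2)"
      unfolding power2_norm_eq_inner by (subst euclidean_inner) (simp add: power2_eq_square inner_commute)
    then show ?thesis by (simp add: inner_S power_divide)
  qed
  note sm = second_moment_sum_indep[OF noise_indep noise_sq(1) noise_mean]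
  have int: "integrable M (\<lambda>\<omega>. (norm (S n \<omega>))\<^sup>2)" for n
    unfolding S2 using sm by simp
  have E: "expectation (\<lambda>\<omega>. (norm (S n \<omega>))\<^sup>2) = c" if "1 \<le> n" for n
    unfolding S2 using sm that by (simp add: noise_sq c_def)
  have "0 \<le> c" unfolding E[of 1, symmetric, simplified] by simp
  \<comment> \<open>Makes \<open>c / R\<^sup>2 < e\<close>; the added 1 keeps \<open>R\<close>
    positive when \<open>c = 0\<close>.\<close>
  define R where "R = sqrt ((c + 1) / e)"
  have R2: "R\<^sup>2 = (c + 1) / e" and "0 < R" using \<open>0 < e\<close> \<open>0 \<le> c\<close> by (auto simp: R_def)
  have "prob {\<omega>\<in>space M. R < norm (S n \<omega>)} < e" if "1 \<le> n" for n
  proof -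
    have "prob {\<omega>\<in>space M. R < norm (S n \<omega>)} \<le> prob {\<omega>\<in>space M. R\<^sup>2 \<le> (norm (S n \<omega>))\<^sup>2}"
      using \<open>0 < R\<close> by (intro finite_measure_mono) (auto intro: power_mono)
    also have "\<dots> \<le> c / R\<^sup>2"
      using integral_Markov_inequality_measure[where A="{}" and c="R\<^sup>2", OF int[of n]] \<open>0 < R\<close> E[OF that] by simp
    also have "\<dots> < e" using \<open>0 < e\<close> \<open>0 \<le> c\<close> unfolding R2 by (simp add: field_simps)
    finally show ?thesis .
  qed
  then show ?thesis by (intro exI[of _ R] eventually_sequentiallyI[of 1]) auto
qed

text \<open>Cosine and sine waves depend on a single projection \<open>t \<bullet> S n\<close>. Its
  limit is the scalar normal law that \<open>mv_normal\<close> prescribes for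
  \<open>t \<bullet> W\<close>.\<close>

lemma S_weak_convergence:
  fixes h :: "real^'p \<Rightarrow> real"
  assumes W: "mv_normal N W 0 (\<sigma>\<^sup>2 *\<^sub>R C)" and h: "continuous_on UNIV h" "bounded (range h)"
  shows "(\<lambda>n. expectation (\<lambda>\<omega>. h (S n \<omega>))) \<longlonglongrightarrow> (\<integral>\<omega>. h (W \<omega>) \<partial>N)"
proof -
  have "prob_space N" and [measurable]: "W \<in> borel_measurable N"
    and Wt: "\<And>t. distr N borel (\<lambda>\<omega>. t \<bullet> W \<omega>) = normal_law 0 (t \<bullet> ((\<sigma>\<^sup>2 *\<^sub>R C) *v t))"
    using W by (auto simp: mv_normal_def)
  have conv: "(\<lambda>n. expectation (\<lambda>\<omega>. g (t \<bullet> S n \<omega>))) \<longlonglongrightarrow> (\<integral>\<omega>. g (t \<bullet> W \<omega>) \<partial>N)"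
    if g: "continuous_on UNIV g" "\<And>x. \<bar>g x\<bar> \<le> 1" for g :: "real \<Rightarrow> real" and t
  proof -
    have [measurable]: "g \<in> borel_measurable borel" using g(1) by (rule borel_measurable_continuous_onI)
    have "(\<integral>\<omega>. g (t \<bullet> W \<omega>) \<partial>N) = (\<integral>x. g x \<partial>normal_law 0 (t \<bullet> ((\<sigma>\<^sup>2 *\<^sub>R C) *v t)))"
      unfolding Wt[symmetric] by (subst integral_distr) auto
    then show ?thesis
      unfolding inner_S
      using central_limit_theorem_normal_law[OF noise_indep noise_distr noise_sq(1) noise_mean noise_sq(2) g] by simp
  qed
  show ?thesis
    by (rule weak_convergence_of_trig[OF prob_space_axioms \<open>prob_space N\<close> _ _ _ _ S_tight h])
       (auto intro!: conv continuous_intros)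
qed

lemma gram_error_measurable [measurable]: "gram_error n \<in> borel_measurable M"
  unfolding gram_error_def gram_def by (simp, measurable)

text \<open>Each entry is an average of i.i.d. integrable products with mean
  \<open>C $ j $ k\<close>. Summing finitely many \<open>L\<^sup>1\<close> limits and applying
  Markov's inequality gives convergence in probability.\<close>

lemma gram_error_tendsto:
  assumes "0 < h"
  shows "(\<lambda>n. prob {\<omega>\<in>space M. h \<le> gram_error n \<omega>}) \<longlonglongrightarrow> 0"
proof -
  have L: "(\<lambda>n. expectation (\<lambda>\<omega>. \<bar>(\<Sum>i<n. X i \<omega> $ j * X i \<omega> $ k) / n - C $ j $ k\<bar>)) \<longlonglongrightarrow> 0" for j k
  proof -
    have "indep_vars (\<lambda>_. borel) (\<lambda>i \<omega>. X i \<omega> $ j * X i \<omega> $ k) UNIV"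
      using indep_vars_compose2[OF X_indep, of "\<lambda>_ x. x $ j * x $ k" "\<lambda>_. borel"] by simp
    moreover have "distr M borel (\<lambda>\<omega>. X i \<omega> $ j * X i \<omega> $ k) = distr (distr M borel (X i)) borel (\<lambda>x. x $ j * x $ k)" for i
      by (subst distr_distr) (auto simp: comp_def)
    moreover from this have "distr M borel (\<lambda>\<omega>. X i \<omega> $ j * X i \<omega> $ k)
        = distr M borel (\<lambda>\<omega>. X 0 \<omega> $ j * X 0 \<omega> $ k)" for i
      by (simp only: X_distr[of i])
    ultimately show ?thesis
      using L1_law_of_large_numbers[of "\<lambda>i \<omega>. X i \<omega> $ j * X i \<omega> $ k"] X_product_integrable
      by (simp add: X_product_mean)
  qed
  have ge: "gram_error n \<omega> = (\<Sum>j\<in>UNIV. \<Sum>k\<in>UNIV. \<bar>(\<Sum>i<n. X i \<omega> $ j * X i \<omega> $ k) / n - C $ j $ k\<bar>)" for n \<omega>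
    by (simp add: gram_error_def gram_def)
  have int: "integrable M (gram_error n)" for n
    unfolding ge[abs_def] using X_product_integrable by simp
  have "(\<lambda>n. \<Sum>j\<in>UNIV. \<Sum>k\<in>UNIV. expectation (\<lambda>\<omega>. \<bar>(\<Sum>i<n. X i \<omega> $ j * X i \<omega> $ k) / n - C $ j $ k\<bar>))
      \<longlonglongrightarrow> (\<Sum>j\<in>(UNIV::'p set). \<Sum>k\<in>(UNIV::'p set). 0)"
    by (intro tendsto_sum L)
  then have "(\<lambda>n. expectation (gram_error n) / h) \<longlonglongrightarrow> 0 / h"
    unfolding ge[abs_def] using X_product_integrable \<open>0 < h\<close> by (intro tendsto_divide) auto
  then have lim: "(\<lambda>n. expectation (gram_error n) / h) \<longlonglongrightarrow> 0" by simp
  show ?thesis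
  proof (rule tendsto_sandwich[OF _ _ tendsto_const lim])
    have "prob {\<omega>\<in>space M. h \<le> gram_error n \<omega>} \<le> expectation (gram_error n) / h" for n
      using \<open>0 < h\<close> by (intro integral_Markov_inequality_measure[where A="{}", OF int])
        (auto simp: gram_error_def intro!: sum_nonneg)
    then show "\<forall>\<^sub>F n in sequentially. prob {\<omega>\<in>space M. h \<le> gram_error n \<omega>} \<le> expectation (gram_error n) / h"
      by simp
  qed simp
qed

text \<open>Continuous mapping handles \<open>A\<close> applied to the score. Off an event of small
  probability the rescaled estimator stays near this, within a ball on which the test function is
  uniformly continuous, so the two expectations have the same limit.\<close>

lemma penalized_ls_estimator_conv_in_distribution:
  fixes f :: "real^'p \<Rightarrow> real" and \<rho> :: "nat \<Rightarrow> real^'p \<Rightarrow> real" and W :: "'b \<Rightarrow> real^'p"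
  assumes y: "\<And>i \<omega>. \<omega> \<in> space M \<Longrightarrow> y i \<omega> = X i \<omega> \<bullet> \<beta> + \<epsilon> i \<omega>"
    and C: "pos_def C" and f: "convex_on UNIV f" and W: "mv_normal N W 0 (\<sigma>\<^sup>2 *\<^sub>R C)"
    and pen: "\<And>n. 1 \<le> n \<Longrightarrow> convex_on UNIV (\<lambda>b. sqrt n * (f b + \<rho> n b))"
    and \<rho>: "\<And>n. 1 \<le> n \<Longrightarrow> (c n)-lipschitz_on UNIV (\<rho> n)" and c: "c \<longlonglongrightarrow> 0"
    and bh: "penalized_ls_estimator M X y (\<lambda>n b. sqrt (real n) * (f b + \<rho> n b)) bh"
  shows "conv_in_distribution M (\<lambda>n \<omega>. sqrt (real n) *\<^sub>R (bh n \<omega> - \<beta>))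
    N (\<lambda>\<omega>. arg_min (limit_objective C f \<beta> (W \<omega>)) (\<lambda>_. True))"
proof -
  obtain l where "0 < l" and l: "\<And>u. l * (norm u)\<^sup>2 \<le> u \<bullet> (C *v u)"
    using pos_def_coercive[OF C] by metis
  define A where "A = limit_argmin C f \<beta>"
  have A_lip: "norm (A w - A w') \<le> 2 / l * norm (w - w')" for w w'
    unfolding A_def by (rule limit_argmin_lipschitz[OF f \<open>0 < l\<close> l])
  have "(2 / l)-lipschitz_on UNIV A"
    using A_lip \<open>0 < l\<close> by (intro lipschitz_onI) (auto simp: dist_norm)
  then have A_cont: "continuous_on UNIV A" by (rule lipschitz_on_continuous_on)
  have [measurable]: "A \<in> borel_measurable borel" using A_cont by (rule borel_measurable_continuous_onI)
  have [measurable]: "W \<in> borel_measurable N" using W by (simp add: mv_normal_def)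
  have [measurable]: "bh n \<in> borel_measurable M" for n
    using bh by (simp add: penalized_ls_estimator_def)
  define Z where "Z n \<omega> = sqrt (real n) *\<^sub>R (bh n \<omega> - \<beta>)" for n \<omega>
  have Z_meas [measurable]: "Z n \<in> borel_measurable M" for n unfolding Z_def by measurable
  have "(\<lambda>n. expectation (\<lambda>\<omega>. h (Z n \<omega>))) \<longlonglongrightarrow> (\<integral>\<omega>. h (A (W \<omega>)) \<partial>N)"
    if h: "continuous_on UNIV h" "bounded (range h)" for h :: "real^'p \<Rightarrow> real"
  proof -
    have [measurable]: "h \<in> borel_measurable borel" using h(1) by (rule borel_measurable_continuous_onI)
    obtain B where B: "\<And>x. \<bar>h x\<bar> \<le> B" using h(2) by (auto simp: bounded_iff)
    have "0 \<le> B" using B[of 0] by linarith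
    have lim: "(\<lambda>n. expectation (\<lambda>\<omega>. h (A (S n \<omega>)))) \<longlonglongrightarrow> (\<integral>\<omega>. h (A (W \<omega>)) \<partial>N)"
    proof (rule S_weak_convergence[OF W])
      show "continuous_on UNIV (\<lambda>w. h (A w))"
        using continuous_on_compose2[OF h(1) A_cont] by simp
      show "bounded (range (\<lambda>w. h (A w)))" using B by (auto simp: bounded_iff)
    qed
    have diff: "(\<lambda>n. expectation (\<lambda>\<omega>. h (Z n \<omega>)) - expectation (\<lambda>\<omega>. h (A (S n \<omega>)))) \<longlonglongrightarrow> 0"
    proof (rule LIMSEQ_I)
      fix r :: real assume "0 < r"
      \<comment> \<open>The difference is at most \<open>e\<close> off \<open>Bad\<close> and
        \<open>2 * B\<close> on \<open>Bad\<close>, whose probability is below \<open>2 * e\<close>.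
        The total \<open>(4 * B + 1) * e\<close> is less than \<open>r\<close>.\<close>
      define e where "e = r / (4 * B + 2)"
      have "0 < e" using \<open>0 < r\<close> \<open>0 \<le> B\<close> by (simp add: e_def)
      have er: "(4 * B + 2) * e = r" using \<open>0 \<le> B\<close> by (simp add: e_def)
      obtain R where R: "\<forall>\<^sub>F n in sequentially. prob {\<omega>\<in>space M. R < norm (S n \<omega>)} < e"
        using S_tight[OF \<open>0 < e\<close>] by blast
      \<comment> \<open>A ball containing both \<open>A (S n \<omega>)\<close> and the rescaled
        estimator at good outcomes; the summand 1 allows for \<open>d \<le> 1\<close>.\<close>
      define R2 where "R2 = norm (A 0) + 2 / l * \<bar>R\<bar> + 1"
      have "uniformly_continuous_on (cball 0 R2) h"
        by (intro compact_uniformly_continuous continuous_on_subset[OF h(1)]) auto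
      then obtain d0 where "0 < d0" and d0: "\<And>x x'. norm x \<le> R2 \<Longrightarrow> norm x' \<le> R2 \<Longrightarrow>
          dist x x' < d0 \<Longrightarrow> \<bar>h x - h x'\<bar> < e"
        using \<open>0 < e\<close> unfolding uniformly_continuous_on_def by (fastforce simp: dist_real_def)
      define d where "d = min 1 (d0 / 2)"
      have d: "0 < d" "d \<le> 1" "d < d0" using \<open>0 < d0\<close> by (auto simp: d_def)
      obtain a where "0 < a" and a: "\<forall>\<^sub>F n in sequentially. \<forall>x y e. (\<forall>i<n. y i = x i \<bullet> \<beta> + e i) \<longrightarrow>
          norm (score n x e) \<le> R \<longrightarrow> (\<Sum>j\<in>UNIV. \<Sum>k\<in>UNIV. \<bar>gram n x $ j $ k - C $ j $ k\<bar>) \<le> a \<longrightarrow>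
          (let P = penalized_ls n x y (\<lambda>b. sqrt n * (f b + \<rho> n b)) in
            (\<exists>b. is_arg_min P (\<lambda>_. True) b) \<and>
            (\<forall>b. is_arg_min P (\<lambda>_. True) b \<longrightarrow>
              dist (sqrt n *\<^sub>R (b - \<beta>)) (limit_argmin C f \<beta> (score n x e)) \<le> d))"
        using penalized_ls_argmin_near_limit_argmin[OF f C d(1) pen \<rho> c, of \<beta> R] by blast
      have ga: "\<forall>\<^sub>F n in sequentially. prob {\<omega>\<in>space M. a \<le> gram_error n \<omega>} < e"
        using gram_error_tendsto[OF \<open>0 < a\<close>] \<open>0 < e\<close> by (rule order_tendstoD)
      have "\<forall>\<^sub>F n in sequentially. norm (expectation (\<lambda>\<omega>. h (Z n \<omega>)) - expectation (\<lambda>\<omega>. h (A (S n \<omega>))) - 0) < r"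
        using R a ga
      proof eventually_elim
        case (elim n)
        define Bad where "Bad = {\<omega>\<in>space M. R < norm (S n \<omega>)} \<union> {\<omega>\<in>space M. a \<le> gram_error n \<omega>}"
        have [measurable]: "Bad \<in> events" unfolding Bad_def by measurable
        have "prob Bad \<le> prob {\<omega>\<in>space M. R < norm (S n \<omega>)} + prob {\<omega>\<in>space M. a \<le> gram_error n \<omega>}"
          unfolding Bad_def by (rule measure_Un_le) measurable
        then have pB: "prob Bad < 2 * e" using elim by linarith
        have good: "\<bar>h (Z n \<omega>) - h (A (S n \<omega>))\<bar> \<le> e" if \<omega>: "\<omega> \<in> space M" "\<omega> \<notin> Bad" for \<omega>
        proof -
          have w: "norm (S n \<omega>) \<le> R" and g: "gram_error n \<omega> \<le> a" using \<omega> by (auto simp: Bad_def)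
          let ?P = "penalized_ls n (\<lambda>i. X i \<omega>) (\<lambda>i. y i \<omega>) (\<lambda>b. sqrt n * (f b + \<rho> n b))"
          have P: "\<exists>b. is_arg_min ?P (\<lambda>_. True) b"
            "\<And>b. is_arg_min ?P (\<lambda>_. True) b \<Longrightarrow> dist (sqrt n *\<^sub>R (b - \<beta>)) (A (S n \<omega>)) \<le> d"
            using elim(2)[rule_format, of "\<lambda>i. y i \<omega>" "\<lambda>i. X i \<omega>" "\<lambda>i. \<epsilon> i \<omega>"] y[OF \<omega>(1)] w g
            unfolding Let_def S_def gram_error_def A_def by blast+
          \<comment> \<open>The estimator is constrained only where a minimizer exists, which is why
            the deterministic lemma also supplies existence.\<close>
          have "is_arg_min ?P (\<lambda>_. True) (bh n \<omega>)"
            using bh P(1) \<omega>(1) unfolding penalized_ls_estimator_def by blast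
          from P(2)[OF this] have dist: "dist (Z n \<omega>) (A (S n \<omega>)) \<le> d" by (simp add: Z_def)
          have "norm (A (S n \<omega>) - A 0) \<le> 2 / l * norm (S n \<omega>)" using A_lip[of "S n \<omega>" 0] by simp
          also have "\<dots> \<le> 2 / l * \<bar>R\<bar>" using w \<open>0 < l\<close> by (intro mult_left_mono) auto
          finally have "norm (A (S n \<omega>)) \<le> norm (A 0) + 2 / l * \<bar>R\<bar>"
            using norm_triangle_sub[of "A (S n \<omega>)" "A 0"] by linarith
          moreover have "norm (Z n \<omega>) \<le> norm (A (S n \<omega>)) + d"
            using norm_triangle_sub[of "Z n \<omega>" "A (S n \<omega>)"] dist by (simp add: dist_norm)
          ultimately have "norm (A (S n \<omega>)) \<le> R2" "norm (Z n \<omega>) \<le> R2"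
            using d(2) by (simp_all add: R2_def)
          then show ?thesis using d0[of "Z n \<omega>" "A (S n \<omega>)"] dist d(3) by linarith
        qed
        have "\<bar>expectation (\<lambda>\<omega>. h (Z n \<omega>)) - expectation (\<lambda>\<omega>. h (A (S n \<omega>)))\<bar> \<le> e + (2 * B) * prob Bad"
        proof (rule expectation_diff_le)
          show "integrable M (\<lambda>\<omega>. h (Z n \<omega>))" "integrable M (\<lambda>\<omega>. h (A (S n \<omega>)))"
            by (rule integrable_bounded[where K=B, OF _ B]; measurable)+
          show "\<bar>h (Z n \<omega>) - h (A (S n \<omega>))\<bar> \<le> 2 * B" for \<omega>
            using B[of "Z n \<omega>"] B[of "A (S n \<omega>)"] by linarith
        qed (use good \<open>0 < e\<close> \<open>0 \<le> B\<close> in auto)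
        also have "\<dots> \<le> e + (2 * B) * (2 * e)"
          using pB \<open>0 \<le> B\<close> by (intro add_left_mono mult_left_mono) auto
        also have "\<dots> < r" using er \<open>0 < e\<close> by (simp add: algebra_simps)
        finally show ?case by simp
      qed
      then show "\<exists>no. \<forall>n\<ge>no. norm (expectation (\<lambda>\<omega>. h (Z n \<omega>)) - expectation (\<lambda>\<omega>. h (A (S n \<omega>))) - 0) < r"
        by (simp add: eventually_sequentially)
    qed
    show ?thesis using tendsto_add[OF diff lim] by simp
  qed
  moreover have "(\<lambda>\<omega>. A (W \<omega>)) \<in> borel_measurable N" by measurable
  ultimately show ?thesis
    using Z_meas unfolding conv_in_distribution_def Z_def A_def limit_argmin_def by blast
qed

end

theorem theorem2p1:
  fixes M :: "'a measure" and N :: "'b measure"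
    and X :: "nat \<Rightarrow> 'a \<Rightarrow> real^'p" and \<epsilon> y :: "nat \<Rightarrow> 'a \<Rightarrow> real"
    and \<beta>0 :: "real^'p" and C :: "real^'p^'p" and \<sigma> :: real
    and f :: "real^'p \<Rightarrow> real" and W :: "'b \<Rightarrow> real^'p"
  assumes "prob_space M"
    and "prob_space.indep_vars M (\<lambda>_. borel) X UNIV"
    and "\<And>i. distr M borel (X i) = distr M borel (X 0)"
    and "\<And>i. integrable M (\<lambda>\<omega>. (norm (X i \<omega>))\<^sup>2)"
    and "\<And>i. (\<integral>\<omega>. X i \<omega> \<partial>M) = 0"
    and "\<And>i. covariance_matrix M (X i) = C"
    and "prob_space.indep_vars M (\<lambda>_. borel) \<epsilon> UNIV"
    and "\<And>i. distr M borel (\<epsilon> i) = distr M borel (\<epsilon> 0)"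
    and "\<And>i. integrable M (\<lambda>\<omega>. (\<epsilon> i \<omega>)\<^sup>2)"
    and "\<And>i. (\<integral>\<omega>. \<epsilon> i \<omega> \<partial>M) = 0"
    and "\<And>i. prob_space.variance M (\<epsilon> i) = \<sigma>\<^sup>2"
    and "prob_space.indep_set M
           (sets (vimage_algebra (space M) (\<lambda>\<omega> i. X i \<omega>) (\<Pi>\<^sub>M i\<in>(UNIV::nat set). borel)))
           (sets (vimage_algebra (space M) (\<lambda>\<omega> i. \<epsilon> i \<omega>) (\<Pi>\<^sub>M i\<in>(UNIV::nat set). borel)))"
    and "\<And>i \<omega>. \<omega> \<in> space M \<Longrightarrow> y i \<omega> = X i \<omega> \<bullet> \<beta>0 + \<epsilon> i \<omega>"
    and "pos_def C"
    and "convex_on UNIV f"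
    and "mv_normal N W 0 (\<sigma>\<^sup>2 *\<^sub>R C)"
  shows "(\<forall>\<omega>\<in>space N. \<exists>!u. is_arg_min (limit_objective C f \<beta>0 (W \<omega>)) (\<lambda>_. True) u)
    \<and> (\<forall>bh. penalized_ls_estimator M X y (\<lambda>n b. sqrt (real n) * f b) bh \<longrightarrow>
          conv_in_distribution M (\<lambda>n \<omega>. sqrt (real n) *\<^sub>R (bh n \<omega> - \<beta>0))
            N (\<lambda>\<omega>. arg_min (limit_objective C f \<beta>0 (W \<omega>)) (\<lambda>_. True)))
    \<and> (\<forall>(\<rho> :: nat \<Rightarrow> real^'p \<Rightarrow> real) (c :: nat \<Rightarrow> real) bh.
          (\<forall>n\<ge>1. convex_on UNIV (\<lambda>b. sqrt (real n) * (f b + \<rho> n b))) \<and>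
          (\<forall>b. (\<lambda>n. \<rho> n b) \<longlonglongrightarrow> 0) \<and>
          (\<forall>n\<ge>1. (c n)-lipschitz_on UNIV (\<rho> n)) \<and> c \<longlonglongrightarrow> 0 \<and>
          penalized_ls_estimator M X y (\<lambda>n b. sqrt (real n) * (f b + \<rho> n b)) bh \<longrightarrow>
          conv_in_distribution M (\<lambda>n \<omega>. sqrt (real n) *\<^sub>R (bh n \<omega> - \<beta>0))
            N (\<lambda>\<omega>. arg_min (limit_objective C f \<beta>0 (W \<omega>)) (\<lambda>_. True)))"
proof -
  interpret linear_model M X \<epsilon> C \<sigma>
    by (intro linear_model.intro linear_model_axioms.intro assms)
  note conv = penalized_ls_estimator_conv_in_distribution[OF assms(13) \<open>pos_def C\<close> \<open>convex_on UNIV f\<close> assms(16)]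
  obtain l where "0 < l" "\<And>u. l * (norm u)\<^sup>2 \<le> u \<bullet> (C *v u)"
    using pos_def_coercive[OF \<open>pos_def C\<close>] by metis
  then have "\<exists>!u. is_arg_min (limit_objective C f \<beta>0 (W \<omega>)) (\<lambda>_. True) u" for \<omega>
    by (rule ex1_limit_argmin[OF \<open>convex_on UNIV f\<close>])
  moreover have "conv_in_distribution M (\<lambda>n \<omega>. sqrt (real n) *\<^sub>R (bh n \<omega> - \<beta>0))
      N (\<lambda>\<omega>. arg_min (limit_objective C f \<beta>0 (W \<omega>)) (\<lambda>_. True))"
    if "penalized_ls_estimator M X y (\<lambda>n b. sqrt (real n) * f b) bh" for bh
  proof (rule conv[where \<rho>="\<lambda>_ _. 0" and c="\<lambda>_. 0"])
    show "convex_on UNIV (\<lambda>b. sqrt (real n) * (f b + 0))" for n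
      using convex_on_cmul[OF _ \<open>convex_on UNIV f\<close>, of "sqrt (real n)"] by simp
  qed (use that in \<open>auto intro: lipschitz_intros\<close>)
  ultimately show ?thesis using conv by blast
qed

end
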